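(* Let $d\geq 4$ be an integer and let $t$ be a real number satisfying $$\frac{\sqrt{d}}{2}-\frac{1}{\sqrt{d}}\min\left\{\frac{d-1}{4},\frac{d^{1/(d-3)}}{d^{1/(d-3)}-1}\right\}<t<\frac{\sqrt{d}}{2}.$$ Then the $(d-1)$-dimensional volume of $H\cap[0,1]^d$, where $H$ ranges over the hyperplanes of $\mathbb{R}^d$ at distance $t$ from the center of $[0,1]^d$, has a strict local maximum when $H$ is orthogonal to a diagonal of $[0,1]^d$.
   Context: A diagonal of $[0,1]^d$ is a line segment between two opposite vertices; its unit direction vectors have all coordinates equal to $\pm 1/\sqrt{d}$. For $t\ge 0$ and a unit vector $a\in\mathbb{S}^{d-1}$, let $H_a=\{x\in\mathbb{R}^d: a\cdot x=\tfrac12\sum_{i=1}^d a_i-t\}$; these are exactly the hyperplanes at distance $t$ from the center of $[0,1]^d$. Let $f_t(a)$ be the $(d-1)$-dimensional volume of $H_a\cap[0,1]^d$. Saying that the volume of $H\cap[0,1]^d$ has a strict local maximum when $H$ is orthogonal to a segment $D$ means that $f_t:\mathbb{S}^{d-1}\to\mathbb{R}$ has a strict local maximum at every unit vector $a$ parallel to $D$. *)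

theory Defs
  imports "HOL-Analysis.Analysis"
begin

(* Lebesgue measure of dimension dim H on a nonempty affine subspace H: the image of the
   product Lebesgue measure under isometric coordinates on H, given by an origin p in H and an
   orthonormal basis B of the direction space of H.  This is the definition of lborel with B
   in place of Basis; the result does not depend on the choice of p and B. *)
definition affine_coords :: "'a::euclidean_space set \<Rightarrow> 'a \<Rightarrow> 'a set \<Rightarrow> bool" where
  "affine_coords H p B \<longleftrightarrow>
     p \<in> H \<and> pairwise orthogonal B \<and> (\<forall>b\<in>B. norm b = 1) \<and> span B = {x - y | x y. x \<in> H \<and> y \<in> H}"

definition affine_lborel :: "'a::euclidean_space set \<Rightarrow> 'a measure" where
  "affine_lborel H =
     (let (p, B) = (SOME (p, B). affine_coords H p B)
      in distr (\<Pi>\<^sub>M b\<in>B. (lborel :: real measure)) borel (\<lambda>y. p + (\<Sum>b\<in>B. y b *\<^sub>R b)))"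

definition unit_cube :: "(real ^ 'n) set" where
  "unit_cube = cbox 0 1"

definition section_hyperplane :: "real \<Rightarrow> real ^ 'n \<Rightarrow> (real ^ 'n) set" where
  "section_hyperplane t a = {x. a \<bullet> x = (\<Sum>i\<in>UNIV. a $ i) / 2 - t}"

definition section_volume :: "real \<Rightarrow> real ^ 'n \<Rightarrow> real" where
  "section_volume t a =
     measure (affine_lborel (section_hyperplane t a)) (section_hyperplane t a \<inter> unit_cube)"

(* The vertex opposite to v is 1 - v, where 1 is the all-ones vector. *)
definition cube_diagonal :: "(real ^ 'n) set \<Rightarrow> bool" where
  "cube_diagonal D \<longleftrightarrow> (\<exists>v. (\<forall>i. v $ i \<in> {0, 1}) \<and> D = closed_segment v (1 - v))"

definition parallel_to_segment :: "'a::real_vector \<Rightarrow> 'a set \<Rightarrow> bool" where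
  "parallel_to_segment a D \<longleftrightarrow>
     (\<exists>v w c. v \<noteq> w \<and> D = closed_segment v w \<and> a = c *\<^sub>R (w - v))"

definition strict_local_max_on :: "'a::topological_space set \<Rightarrow> ('a \<Rightarrow> real) \<Rightarrow> 'a \<Rightarrow> bool" where
  "strict_local_max_on S f a \<longleftrightarrow> a \<in> S \<and> (\<forall>\<^sub>F b in at a within S. f b < f a)"

end

theory Submission
  imports Defs
begin

text \<open>Idea of the proof.  Put \<open>d = CARD('n)\<close> and let the unit vector \<open>a\<close> have coordinates
\<open>\<plusminus>(1 + h\<^sub>i) / \<surd>d\<close>; the diagonals are \<open>h = 0\<close>.  The volume of the part of the cube on one
side of the hyperplane is a combination of truncated powers, obtained by integrating out one
coordinate at a time (\<open>halfspace_PiM\<close>), and the volume of the section is its derivative in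
the offset of the hyperplane (\<open>section_measure_eq_derivative\<close>).  This gives the section volume
as the quotient of \<open>\<Sum>\<^sub>K (-1)\<^bsup>|K|\<^esup> (\<sigma> - |K| + (\<Sum>\<^sub>i h\<^sub>i) / 2 - \<Sum>\<^sub>i\<^sub>\<in>\<^sub>K h\<^sub>i)\<^sub>+\<^bsup>d-1\<^esup> / (d-1)!\<close>, where
\<open>K\<close> runs through the sets of coordinates and \<open>\<sigma> = d/2 - t \<surd>d\<close>, by \<open>\<Prod>\<^sub>i (1 + h\<^sub>i)\<close>, times \<open>\<surd>d\<close>.

The numerator is twice continuously differentiable because \<open>d \<ge> 4\<close>.  Being symmetric in the
coordinates, its second-order expansion involves only \<open>\<Sum>\<^sub>i h\<^sub>i\<close> and \<open>q = \<Sum>\<^sub>i h\<^sub>i\<^sup>2\<close>, and on the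
sphere \<open>\<Sum>\<^sub>i h\<^sub>i = - q / 2\<close>.  With the Irwin-Hall densities \<open>p = p\<^sub>d(\<sigma>)\<close>, \<open>A = p\<^sub>d\<^sub>-\<^sub>1(\<sigma>)\<close>,
\<open>B = p\<^sub>d\<^sub>-\<^sub>1(\<sigma> - 1)\<close> and \<open>E = p\<^sub>d\<^sub>-\<^sub>2(\<sigma> - 1)\<close>, where \<open>p\<^sub>n\<close> is the density of a sum of \<open>n\<close>
independent uniform variables on \<open>[0, 1]\<close>, the section volume is
\<open>\<surd>d (p - q (A + B + 2 E - 4 p) / 4 + o(q))\<close> (\<open>perturbed_section_less\<close>).  So everything
reduces to the inequality \<open>4 p < A + B + 2 E\<close> (\<open>irwin_hall_curvature\<close>).

The recursion \<open>(d - 1) p = \<sigma> A + (d - \<sigma>) B\<close> rewrites this inequality, multiplied by \<open>d - 1\<close>, as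
\<open>0 < (d - 1 - 4 \<sigma>) (A - B) + 2 ((d - 1) E - (d + 1) B)\<close>.  The bounds on \<open>t\<close> give
\<open>0 < \<sigma> < (d - 1) / 4\<close>, so the first factor is positive and \<open>\<sigma>\<close> lies well to the left of the mode
of the densities.  There \<open>p\<^sub>n\<close> increases so fast that \<open>(n - x) p\<^sub>n(x - 1) \<le> x p\<^sub>n(x)\<close>
(\<open>irwin_hall_ratio\<close>), which yields both \<open>B < A\<close> and \<open>(d + 1) B \<le> (d - 1) E\<close>.\<close>

section \<open>Lebesgue measure in an orthonormal frame\<close>

text \<open>Uniqueness of Haar measure, in the form needed for rotations.  Both sides of
\<open>\<mu>(A) \<lambda>(D) = \<mu>(D) \<lambda>(A)\<close> compute the double integral of \<open>1\<^sub>A(x) 1\<^sub>D(x + y)\<close>: integrating over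
\<open>y\<close> first gives the left-hand side, and substituting \<open>x - y\<close> for \<open>x\<close> before integrating over
\<open>y\<close> gives the right-hand side.  The ball \<open>D\<close> is the normalisation because rotations fix it.\<close>
lemma translation_invariant_eq_lborel:
  fixes \<mu> :: "'a::euclidean_space measure"
  assumes sets_mu [measurable_cong]: "sets \<mu> = sets borel"
    and "sigma_finite_measure \<mu>"
    and inv: "\<And>v. distr \<mu> borel (\<lambda>x. x + v) = \<mu>"
    and ball: "emeasure \<mu> (ball 0 1) = emeasure lborel (ball (0::'a) 1)"
  shows "\<mu> = lborel"
proof (rule measure_eqI)
  fix A assume "A \<in> sets \<mu>"
  then have A [measurable]: "A \<in> sets borel" by (simp add: sets_mu)
  interpret mu: sigma_finite_measure \<mu> by fact
  interpret pair_sigma_finite \<mu> lborel by unfold_locales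
  define D where "D = (ball 0 1 :: 'a set)"
  have D [measurable]: "D \<in> sets borel" by (simp add: D_def)
  let ?i = "\<lambda>S x. indicator S x :: ennreal"
  have shift: "(\<integral>\<^sup>+ y. ?i D (x + y) \<partial>lborel) = emeasure lborel D" for x
  proof -
    have "(\<integral>\<^sup>+ y. ?i D (x + y) \<partial>lborel) = (\<integral>\<^sup>+ z. ?i D z \<partial>distr lborel borel ((+) x))"
      by (subst nn_integral_distr) auto
    then show ?thesis by (simp add: lborel_distr_plus)
  qed
  have lborel_reflect: "distr lborel borel (\<lambda>y. x - y) = lborel" for x :: 'a
    using lborel_affine[of "-1" x] by (simp add: density_1)
  have reflect: "(\<integral>\<^sup>+ y. ?i A (x - y) \<partial>lborel) = emeasure lborel A" for x
  proof -
    have "(\<integral>\<^sup>+ y. ?i A (x - y) \<partial>lborel) = (\<integral>\<^sup>+ z. ?i A z \<partial>distr lborel borel (\<lambda>y. x - y))"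
      by (subst nn_integral_distr) auto
    then show ?thesis by (simp add: lborel_reflect)
  qed
  have mu_shift: "(\<integral>\<^sup>+ x. ?i A x * ?i D (x + y) \<partial>\<mu>) = (\<integral>\<^sup>+ x. ?i A (x - y) * ?i D x \<partial>\<mu>)" for y
  proof -
    have "(\<integral>\<^sup>+ x. ?i A (x - y) * ?i D x \<partial>\<mu>)
        = (\<integral>\<^sup>+ x. ?i A (x - y) * ?i D x \<partial>distr \<mu> borel (\<lambda>x. x + y))"
      by (simp add: inv)
    also have "\<dots> = (\<integral>\<^sup>+ x. ?i A x * ?i D (x + y) \<partial>\<mu>)"
      by (subst nn_integral_distr) auto
    finally show ?thesis by simp
  qed
  have "emeasure \<mu> A * emeasure lborel D = (\<integral>\<^sup>+ x. ?i A x * emeasure lborel D \<partial>\<mu>)"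
    by (subst nn_integral_multc) (auto simp: sets_mu)
  also have "\<dots> = (\<integral>\<^sup>+ x. \<integral>\<^sup>+ y. ?i A x * ?i D (x + y) \<partial>lborel \<partial>\<mu>)"
    by (subst nn_integral_cmult) (auto simp: shift)
  also have "\<dots> = (\<integral>\<^sup>+ y. \<integral>\<^sup>+ x. ?i A x * ?i D (x + y) \<partial>\<mu> \<partial>lborel)"
    by (rule Fubini'[symmetric]) measurable
  also have "\<dots> = (\<integral>\<^sup>+ y. \<integral>\<^sup>+ x. ?i A (x - y) * ?i D x \<partial>\<mu> \<partial>lborel)"
    by (simp add: mu_shift)
  also have "\<dots> = (\<integral>\<^sup>+ x. \<integral>\<^sup>+ y. ?i A (x - y) * ?i D x \<partial>lborel \<partial>\<mu>)"
    by (rule Fubini') measurable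
  also have "\<dots> = (\<integral>\<^sup>+ x. emeasure lborel A * ?i D x \<partial>\<mu>)"
    by (subst nn_integral_multc) (auto simp: reflect)
  also have "\<dots> = emeasure lborel A * emeasure lborel D"
    by (subst nn_integral_cmult) (simp_all add: ball[folded D_def])
  finally have *: "emeasure \<mu> A * emeasure lborel D = emeasure lborel A * emeasure lborel D" .
  have "emeasure lborel D \<noteq> 0"
  proof -
    have "D \<notin> null_sets lborel"
      using open_not_negligible[of D] by (auto simp: D_def negligible_iff_null_sets null_sets_completion_iff)
    then show ?thesis by (auto simp: null_sets_def)
  qed
  moreover have "emeasure lborel D \<noteq> top"
    using emeasure_lborel_ball_finite[of "0::'a" 1] by (simp add: D_def less_top)
  ultimately show "emeasure \<mu> A = emeasure lborel A"
    using * by (simp add: mult.commute[of _ "emeasure lborel D"] ennreal_mult_cancel_left)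
qed (simp add: sets_mu)

lemma distr_lborel_orthogonal_transformation:
  fixes T :: "'a::euclidean_space \<Rightarrow> 'a"
  assumes T: "orthogonal_transformation T"
  shows "distr lborel borel T = lborel"
proof (rule translation_invariant_eq_lborel)
  have lin: "linear T" using T by (rule orthogonal_transformation_linear)
  have [measurable]: "T \<in> borel_measurable borel"
    using lin by (intro borel_measurable_continuous_onI linear_continuous_on) (simp add: linear_conv_bounded_linear)
  have vim: "T -` ball 0 1 = ball 0 1"
    using T by (auto simp: orthogonal_transformation_norm)
  show ball: "emeasure (distr lborel borel T) (ball 0 1) = emeasure lborel (ball (0::'a) 1)"
    by (subst emeasure_distr) (auto simp: vim)
  show "sigma_finite_measure (distr lborel borel T)"
  proof
    let ?A = "range (\<lambda>n::nat. ball (0::'a) (real n))"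
    have vim: "T -` ball 0 r = ball 0 r" for r
      using T by (auto simp: orthogonal_transformation_norm)
    show "\<exists>A. countable A \<and> A \<subseteq> sets (distr lborel borel T) \<and> \<Union>A = space (distr lborel borel T)
        \<and> (\<forall>a\<in>A. emeasure (distr lborel borel T) a \<noteq> \<infinity>)"
    proof (intro exI[of _ ?A] conjI ballI)
      show "\<Union> ?A = space (distr lborel borel T)"
        using reals_Archimedean2 by auto
      fix a assume "a \<in> ?A"
      then obtain n :: nat where a: "a = ball 0 (real n)" by auto
      have "emeasure (distr lborel borel T) a = emeasure lborel (ball (0::'a) (real n))"
        by (subst emeasure_distr) (auto simp: vim a)
      then show "emeasure (distr lborel borel T) a \<noteq> \<infinity>"
        using emeasure_lborel_ball_finite[of "0::'a" "real n"] by (auto simp: top.not_eq_extremum)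
    qed auto
  qed
  fix v
  obtain w where w: "v = T w"
    using orthogonal_transformation_surj[OF T] by (metis surjD)
  have "distr (distr lborel borel T) borel (\<lambda>x. x + v) = distr lborel borel ((\<lambda>x. x + v) \<circ> T)"
    by (subst distr_distr) auto
  also have "(\<lambda>x. x + v) \<circ> T = T \<circ> (+) w"
    by (auto simp: w linear_add[OF lin] add.commute)
  also have "distr lborel borel (T \<circ> (+) w) = distr (distr lborel borel ((+) w)) borel T"
    by (subst distr_distr) auto
  finally show "distr (distr lborel borel T) borel (\<lambda>x. x + v) = distr lborel borel T"
    by (simp add: lborel_distr_plus)
qed simp

text \<open>The defining property of Lebesgue measure holds for every orthonormal basis, since the linear
map carrying the standard basis to it is orthogonal.\<close>
lemma distr_PiM_orthonormal_basis:
  fixes C :: "'a::euclidean_space set"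
  assumes orth: "pairwise orthogonal C" and unit: "\<And>c. c \<in> C \<Longrightarrow> norm c = 1"
    and card: "card C = DIM('a)" and fin: "finite C"
  shows "distr (\<Pi>\<^sub>M c\<in>C. (lborel :: real measure)) borel (\<lambda>f. \<Sum>c\<in>C. f c *\<^sub>R c) = lborel"
proof -
  obtain g where g: "bij_betw g (Basis :: 'a set) C"
    using finite_same_card_bij[OF finite_Basis fin] card by auto
  define g' where "g' = inv_into Basis g"
  have g': "bij_betw g' C Basis"
    unfolding g'_def by (rule bij_betw_inv_into[OF g])
  have gC: "g b \<in> C" if "b \<in> Basis" for b using g that by (auto simp: bij_betw_def)
  have gg': "g (g' c) = c" if "c \<in> C" for c
    unfolding g'_def using g that by (simp add: bij_betw_inv_into_right)
  have g'g: "g' (g b) = b" if "b \<in> Basis" for b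
    unfolding g'_def using g that by (simp add: bij_betw_inv_into_left)
  have g'B: "g' c \<in> Basis" if "c \<in> C" for c using g' that by (auto simp: bij_betw_def)
  define T where "T = (\<lambda>x::'a. \<Sum>b\<in>Basis. (x \<bullet> b) *\<^sub>R g b)"
  have inner_g: "g b \<bullet> g b' = (if b = b' then 1 else 0)" if "b \<in> Basis" "b' \<in> Basis" for b b'
  proof (cases "b = b'")
    case True
    then show ?thesis using unit[OF gC[OF that(1)]] by (simp add: norm_eq_1)
  next
    case False
    then have "g b \<noteq> g b'" using g that by (auto simp: bij_betw_def inj_on_def)
    then show ?thesis using orth gC that False by (auto simp: pairwise_def orthogonal_def)
  qed
  have T: "orthogonal_transformation T"
    unfolding orthogonal_transformation_def
  proof (intro conjI allI)
    show "linear T" unfolding T_def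
      by (intro linearI) (simp_all add: inner_add_left scaleR_add_left sum.distrib scaleR_sum_right)
    fix v w
    have "T v \<bullet> T w = (\<Sum>b\<in>Basis. \<Sum>b'\<in>Basis. (v \<bullet> b) * (w \<bullet> b') * (g b \<bullet> g b'))"
      unfolding T_def by (subst inner_sum_left, simp add: inner_sum_right sum_distrib_left mult_ac)
    also have "\<dots> = (\<Sum>b\<in>Basis. \<Sum>b'\<in>Basis. if b = b' then (v \<bullet> b) * (w \<bullet> b') else 0)"
      by (intro sum.cong refl) (auto simp: inner_g)
    also have "\<dots> = v \<bullet> w"
      by (simp add: euclidean_inner[of v w])
    finally show "T v \<bullet> T w = v \<bullet> w" .
  qed
  interpret product_sigma_finite "\<lambda>_::'a. lborel :: real measure"
    by standard
  let ?P = "\<lambda>I::'a set. \<Pi>\<^sub>M c\<in>I. (lborel :: real measure)"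
  define r where "r = (\<lambda>f. \<lambda>c\<in>C. f (g' c) :: real)"
  have r_meas [measurable]: "r \<in> measurable (?P Basis) (?P C)"
    unfolding r_def using g'B by (intro measurable_restrict measurable_component_singleton) auto
  have reindex: "distr (?P Basis) (?P C) r = ?P C"
  proof (rule PiM_eqI[OF fin])
    show "sets (distr (?P Basis) (?P C) r) = sets (?P C)" by simp
    fix A :: "'a \<Rightarrow> real set" assume A: "\<And>i. i \<in> C \<Longrightarrow> A i \<in> sets lborel"
    have vim: "r -` Pi\<^sub>E C A \<inter> space (?P Basis) = Pi\<^sub>E Basis (\<lambda>b. A (g b))"
    proof (intro set_eqI iffI)
      fix f assume f: "f \<in> r -` Pi\<^sub>E C A \<inter> space (?P Basis)"
      have "f b \<in> A (g b)" if "b \<in> Basis" for b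
      proof -
        have "r f (g b) \<in> A (g b)" using f gC[OF that] by (auto simp: PiE_def)
        then show ?thesis using that by (simp add: r_def gC g'g)
      qed
      then show "f \<in> Pi\<^sub>E Basis (\<lambda>b. A (g b))" using f by (auto simp: space_PiM PiE_def)
    next
      fix f assume f: "f \<in> Pi\<^sub>E Basis (\<lambda>b. A (g b))"
      have "f (g' c) \<in> A c" if "c \<in> C" for c
        using PiE_mem[OF f g'B[OF that]] by (simp add: gg' that)
      then show "f \<in> r -` Pi\<^sub>E C A \<inter> space (?P Basis)"
        using f by (auto simp: space_PiM r_def PiE_def)
    qed
    have "emeasure (distr (?P Basis) (?P C) r) (Pi\<^sub>E C A) = emeasure (?P Basis) (Pi\<^sub>E Basis (\<lambda>b. A (g b)))"
      using A fin by (subst emeasure_distr) (auto simp: vim intro!: sets_PiM_I_finite)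
    also have "\<dots> = (\<Prod>b\<in>Basis. emeasure lborel (A (g b)))"
      using A gC by (subst emeasure_PiM) auto
    also have "\<dots> = (\<Prod>c\<in>C. emeasure lborel (A c))"
      by (rule prod.reindex_bij_betw[OF g])
    finally show "emeasure (distr (?P Basis) (?P C) r) (Pi\<^sub>E C A) = (\<Prod>c\<in>C. emeasure lborel (A c))" .
  qed
  have T_meas [measurable]: "T \<in> borel_measurable borel"
    using orthogonal_transformation_linear[OF T]
    by (intro borel_measurable_continuous_onI linear_continuous_on) (simp add: linear_conv_bounded_linear)
  have comp_m [measurable]: "(\<lambda>f. \<Sum>c\<in>I. f c *\<^sub>R c) \<in> borel_measurable (?P I)" for I :: "'a set"
    by measurable
  have "distr (?P C) borel (\<lambda>f. \<Sum>c\<in>C. f c *\<^sub>R c)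
      = distr (?P Basis) borel ((\<lambda>f. \<Sum>c\<in>C. f c *\<^sub>R c) \<circ> r)"
    by (subst reindex[symmetric], subst distr_distr) (auto simp: comp_m)
  also have "(\<lambda>f. \<Sum>c\<in>C. f c *\<^sub>R c) \<circ> r = T \<circ> (\<lambda>f. \<Sum>b\<in>Basis. f b *\<^sub>R b)"
  proof
    fix f :: "'a \<Rightarrow> real"
    have "(\<Sum>c\<in>C. r f c *\<^sub>R c) = (\<Sum>c\<in>C. f (g' c) *\<^sub>R g (g' c))"
      by (intro sum.cong) (auto simp: r_def gg')
    also have "\<dots> = (\<Sum>b\<in>Basis. f b *\<^sub>R g b)"
      by (rule sum.reindex_bij_betw[OF g'])
    also have "\<dots> = T (\<Sum>b\<in>Basis. f b *\<^sub>R b)"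
      unfolding T_def by (intro sum.cong) (auto simp: inner_sum_left inner_Basis if_distrib sum.delta cong: if_cong)
    finally show "((\<lambda>f. \<Sum>c\<in>C. f c *\<^sub>R c) \<circ> r) f = (T \<circ> (\<lambda>f. \<Sum>b\<in>Basis. f b *\<^sub>R b)) f"
      by simp
  qed
  also have "distr (?P Basis) borel (T \<circ> (\<lambda>f. \<Sum>b\<in>Basis. f b *\<^sub>R b)) = distr lborel borel T"
    unfolding lborel_def[where 'a='a] by (subst distr_distr) (auto simp: lborel_eq_real)
  also have "\<dots> = lborel" by (rule distr_lborel_orthogonal_transformation[OF T])
  finally show ?thesis .
qed

section \<open>The section volume as a derivative\<close>

lemma affine_coords_hyperplane_exists:
  fixes a :: "'a::euclidean_space"
  assumes "norm a = 1"
  shows "\<exists>p B. affine_coords {x. a \<bullet> x = s} p B"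
proof -
  have "subspace {z. a \<bullet> z = 0}" by (rule subspace_hyperplane)
  then obtain B where B: "pairwise orthogonal B" "\<And>x. x \<in> B \<Longrightarrow> norm x = 1" "span B = {z. a \<bullet> z = 0}"
    using orthonormal_basis_subspace by metis
  have aa: "a \<bullet> a = 1" using assms by (simp add: norm_eq_1)
  have "{z. a \<bullet> z = 0} = {x - y | x y. x \<in> {x. a \<bullet> x = s} \<and> y \<in> {x. a \<bullet> x = s}}"
  proof (intro set_eqI iffI)
    fix z assume "z \<in> {z. a \<bullet> z = 0}"
    then have "z = (z + s *\<^sub>R a) - s *\<^sub>R a \<and> a \<bullet> (z + s *\<^sub>R a) = s \<and> a \<bullet> (s *\<^sub>R a) = s"
      by (simp add: inner_add_right aa)
    then show "z \<in> {x - y | x y. x \<in> {x. a \<bullet> x = s} \<and> y \<in> {x. a \<bullet> x = s}}" by blast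
  qed (auto simp: inner_diff_right)
  then have "affine_coords {x. a \<bullet> x = s} (s *\<^sub>R a) B"
    using B by (simp add: affine_coords_def aa)
  then show ?thesis by blast
qed

text \<open>Isometric coordinates on the hyperplane \<open>a \<bullet> x = s\<close>, as they occur in the definition of its
Lebesgue measure.\<close>
locale hyperplane_coords =
  fixes a p :: "'a::euclidean_space" and s :: real and B :: "'a set"
  assumes unit: "norm a = 1"
    and coords: "affine_coords {x. a \<bullet> x = s} p B"
begin

abbreviation coord_measure :: "('a \<Rightarrow> real) measure" where
  "coord_measure \<equiv> \<Pi>\<^sub>M b\<in>B. (lborel :: real measure)"

text \<open>At \<open>\<tau> = 0\<close> these are the given coordinates of the hyperplane; varying \<open>\<tau>\<close> translates it along
its unit normal \<open>a\<close>, so that \<open>(\<tau>, y)\<close> are isometric coordinates of the whole space.\<close>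
definition chart :: "real \<Rightarrow> ('a \<Rightarrow> real) \<Rightarrow> 'a" where
  "chart \<tau> y = p + \<tau> *\<^sub>R a + (\<Sum>b\<in>B. y b *\<^sub>R b)"

lemma inner_self_normal: "a \<bullet> a = 1" using unit by (simp add: norm_eq_1)

lemma p_level: "a \<bullet> p = s" using coords by (simp add: affine_coords_def)

lemma orthB: "pairwise orthogonal B" and unitB: "b \<in> B \<Longrightarrow> norm b = 1"
  using coords by (auto simp: affine_coords_def)

lemma spanB: "span B = {z. a \<bullet> z = 0}"
proof -
  have "span B = {x - y | x y. x \<in> {x. a \<bullet> x = s} \<and> y \<in> {x. a \<bullet> x = s}}"
    using coords by (simp add: affine_coords_def)
  also have "\<dots> = {z. a \<bullet> z = 0}"
  proof (intro set_eqI iffI)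
    fix z assume "z \<in> {z. a \<bullet> z = 0}"
    then have "z = (p + z) - p \<and> a \<bullet> (p + z) = s \<and> a \<bullet> p = s"
      by (simp add: inner_add_right p_level)
    then show "z \<in> {x - y | x y. x \<in> {x. a \<bullet> x = s} \<and> y \<in> {x. a \<bullet> x = s}}" by blast
  qed (auto simp: inner_diff_right)
  finally show ?thesis .
qed

lemma aB: "b \<in> B \<Longrightarrow> a \<bullet> b = 0"
  using span_base[of b B] by (simp add: spanB)

lemma a_notin: "a \<notin> B" using aB inner_self_normal by force

lemma finB: "finite B"
proof -
  have "0 \<notin> B" using unitB by force
  then have "independent B" by (rule pairwise_orthogonal_independent[OF orthB])
  then show ?thesis by (rule independent_imp_finite)
qed

lemma orth_frame: "pairwise orthogonal (insert a B)"
  using orthB aB by (auto simp: pairwise_insert orthogonal_def inner_commute)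

lemma card_frame: "card (insert a B) = DIM('a)"
proof -
  have "0 \<notin> insert a B" using unitB unit by force
  then have ind: "independent (insert a B)" by (rule pairwise_orthogonal_independent[OF orth_frame])
  have "x \<in> span (insert a B)" for x
  proof -
    have "x - (a \<bullet> x) *\<^sub>R a \<in> span B" by (simp add: spanB inner_diff_right inner_self_normal)
    then show ?thesis by (auto simp: span_insert)
  qed
  then have "span (insert a B) = UNIV" by auto
  then show ?thesis using basis_card_eq_dim[OF _ _ ind, of UNIV] by (simp add: dim_UNIV)
qed

lemma chart_measurable [measurable]: "chart \<tau> \<in> borel_measurable coord_measure"
  unfolding chart_def by measurable

lemma inner_chart: "a \<bullet> chart \<tau> y = s + \<tau>"
  by (simp add: chart_def inner_add_right p_level inner_self_normal inner_sum_right aB)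

text \<open>Cavalieri's principle, from Fubini's theorem in the orthonormal frame \<open>insert a B\<close>.\<close>
lemma emeasure_lborel_slices:
  assumes [measurable]: "A \<in> sets borel"
  shows "emeasure lborel A =
    (\<integral>\<^sup>+ \<tau>. emeasure coord_measure (chart \<tau> -` A \<inter> space coord_measure) \<partial>lborel)"
proof -
  interpret product_sigma_finite "\<lambda>_::'a. lborel :: real measure"
    by standard
  let ?C = "insert a B"
  let ?P = "\<Pi>\<^sub>M c\<in>?C. (lborel :: real measure)"
  have "distr ?P borel (\<lambda>f. \<Sum>c\<in>?C. f c *\<^sub>R c) = lborel"
    using orth_frame unit unitB card_frame finB
    by (intro distr_PiM_orthonormal_basis) auto
  then have "lborel = distr (distr ?P borel (\<lambda>f. \<Sum>c\<in>?C. f c *\<^sub>R c)) borel ((+) p)"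
    by (simp add: lborel_distr_plus)
  also have "\<dots> = distr ?P borel (\<lambda>f. p + (\<Sum>c\<in>?C. f c *\<^sub>R c))"
    by (subst distr_distr) (auto simp: comp_def)
  finally have "emeasure lborel A = emeasure (distr ?P borel (\<lambda>f. p + (\<Sum>c\<in>?C. f c *\<^sub>R c))) A"
    by simp
  also have "\<dots> = (\<integral>\<^sup>+ z. indicator A z \<partial>distr ?P borel (\<lambda>f. p + (\<Sum>c\<in>?C. f c *\<^sub>R c)))"
    by simp
  also have "\<dots> = (\<integral>\<^sup>+ f. indicator A (p + (\<Sum>c\<in>?C. f c *\<^sub>R c)) \<partial>?P)"
    by (subst nn_integral_distr) auto
  also have "\<dots> = (\<integral>\<^sup>+ \<tau>. \<integral>\<^sup>+ y. indicator A (p + (\<Sum>c\<in>?C. (y(a := \<tau>)) c *\<^sub>R c)) \<partial>coord_measure \<partial>lborel)"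
    by (rule product_nn_integral_insert_rev[OF finB a_notin]) measurable
  also have "\<dots> = (\<integral>\<^sup>+ \<tau>. \<integral>\<^sup>+ y. indicator (chart \<tau> -` A \<inter> space coord_measure) y \<partial>coord_measure \<partial>lborel)"
  proof (intro nn_integral_cong)
    fix \<tau> y assume y: "y \<in> space coord_measure"
    have "(\<Sum>c\<in>?C. (y(a := \<tau>)) c *\<^sub>R c) = \<tau> *\<^sub>R a + (\<Sum>c\<in>B. (y(a := \<tau>)) c *\<^sub>R c)"
      by (subst sum.insert[OF finB a_notin]) simp
    also have "(\<Sum>c\<in>B. (y(a := \<tau>)) c *\<^sub>R c) = (\<Sum>c\<in>B. y c *\<^sub>R c)"
      using a_notin by (intro sum.cong) auto
    finally show "indicator A (p + (\<Sum>c\<in>?C. (y(a := \<tau>)) c *\<^sub>R c))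
        = (indicator (chart \<tau> -` A \<inter> space coord_measure) y :: ennreal)"
      using y by (simp add: indicator_def chart_def add.assoc)
  qed
  also have "\<dots> = (\<integral>\<^sup>+ \<tau>. emeasure coord_measure (chart \<tau> -` A \<inter> space coord_measure) \<partial>lborel)"
    by (intro nn_integral_cong nn_integral_indicator) measurable
  finally show ?thesis .
qed

text \<open>A second hyperplane cuts the first one in a null set unless the two are parallel.  The part of
\<open>w\<close> orthogonal to \<open>a\<close> is the normal of a hyperplane all of whose slices are the set in question,
and that hyperplane is a null set of the whole space.\<close>
lemma null_section_of_hyperplane:
  assumes "\<And>r. w \<noteq> r *\<^sub>R a"
  shows "{y \<in> space coord_measure. w \<bullet> chart 0 y = c} \<in> null_sets coord_measure"
proof -
  define N where "N = {y \<in> space coord_measure. w \<bullet> chart 0 y = c}"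
  have [measurable]: "N \<in> sets coord_measure" unfolding N_def by measurable
  define w' where "w' = w - (w \<bullet> a) *\<^sub>R a"
  define A where "A = {x. w' \<bullet> x = c - (w \<bullet> a) * s}"
  have "w' \<noteq> 0" using assms by (auto simp: w'_def)
  then have "negligible A" unfolding A_def by (intro negligible_hyperplane) auto
  moreover have [measurable]: "A \<in> sets borel" unfolding A_def by (intro borel_closed closed_hyperplane)
  ultimately have "emeasure lborel A = 0"
    by (auto simp: negligible_iff_null_sets null_sets_completion_iff null_sets_def)
  moreover have "chart \<tau> -` A \<inter> space coord_measure = N" for \<tau>
  proof -
    have "w' \<bullet> chart \<tau> y = w \<bullet> chart 0 y - (w \<bullet> a) * s" for y
    proof -
      have "w' \<bullet> chart \<tau> y = w \<bullet> chart \<tau> y - (w \<bullet> a) * (s + \<tau>)"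
        by (simp add: w'_def inner_diff_left inner_chart)
      also have "w \<bullet> chart \<tau> y = w \<bullet> chart 0 y + \<tau> * (w \<bullet> a)"
        by (simp add: chart_def inner_add_right)
      finally show ?thesis by (simp add: algebra_simps)
    qed
    then show ?thesis by (auto simp: A_def N_def)
  qed
  ultimately have "0 = (\<integral>\<^sup>+ \<tau>. emeasure coord_measure N \<partial>(lborel::real measure))"
    using emeasure_lborel_slices[of A] by simp
  also have "\<dots> = emeasure coord_measure N * \<infinity>" by simp
  finally have "emeasure coord_measure N = 0"
    by (metis ennreal_mult_eq_top_iff ennreal_top_neq_zero infinity_ennreal_def)
  then show ?thesis by (auto simp: N_def[symmetric] null_sets_def)
qed

text \<open>The slice measure \<open>V \<tau>\<close> is continuous at \<open>\<tau> = 0\<close> by dominated convergence: the indicator of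
\<open>K\<close> is continuous off the frontier of \<open>K\<close>, whose section is a null set because it lies in finitely
many hyperplanes that are not parallel to the slices.  Since the volume between the levels \<open>s\<close> and
\<open>s + h\<close> is the integral of \<open>V\<close> over \<open>(0, h]\<close>, its quotient by \<open>h\<close> tends to \<open>V 0\<close>.\<close>
lemma section_measure_eq_derivative:
  fixes K :: "'a set" and F :: "('a \<times> real) set"
  assumes K: "compact K"
    and F: "finite F" "frontier K \<subseteq> (\<Union>(w, c)\<in>F. {x. w \<bullet> x = c})"
    and nonparallel: "\<And>w c r. (w, c) \<in> F \<Longrightarrow> w \<noteq> r *\<^sub>R a"
    and deriv: "((\<lambda>r. measure lborel {x\<in>K. a \<bullet> x \<le> r}) has_real_derivative G) (at s)"
  shows "measure coord_measure (chart 0 -` K \<inter> space coord_measure) = G"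
proof -
  interpret product_sigma_finite "\<lambda>_::'a. lborel :: real measure"
    by standard
  let ?M = "coord_measure"
  have K_borel [measurable]: "K \<in> sets borel" using K by (simp add: borel_compact)
  define S where "S = (\<lambda>\<tau>. chart \<tau> -` K \<inter> space ?M)"
  have S_meas [measurable]: "S \<tau> \<in> sets ?M" for \<tau> unfolding S_def by measurable
  obtain R0 where R0: "\<And>x. x \<in> K \<Longrightarrow> norm x \<le> R0"
    using compact_imp_bounded[OF K] by (auto simp: bounded_iff)
  define R where "R = R0 + norm p"
  \<comment> \<open>a box in the coordinates that contains every slice and dominates their indicators\<close>
  define W where "W = (\<Pi>\<^sub>E b\<in>B. {-R..R})"
  have W_meas [measurable]: "W \<in> sets ?M" unfolding W_def using finB by (intro sets_PiM_I_finite) auto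
  have S_W: "S \<tau> \<subseteq> W" for \<tau>
  proof
    fix y assume y: "y \<in> S \<tau>"
    have "\<bar>y b\<bar> \<le> R" if "b \<in> B" for b
    proof -
      have "(\<Sum>c\<in>B. y c *\<^sub>R c) \<bullet> b = (\<Sum>c\<in>B. if c = b then y c else 0)"
        unfolding inner_sum_left
      proof (rule sum.cong[OF refl])
        fix c assume "c \<in> B"
        then show "y c *\<^sub>R c \<bullet> b = (if c = b then y c else 0)"
          using orthB unitB[OF that] that by (auto simp: pairwise_def orthogonal_def norm_eq_1)
      qed
      also have "\<dots> = y b" using finB that by simp
      finally have "(chart \<tau> y - p) \<bullet> b = y b"
        by (simp add: chart_def inner_add_left aB that)
      then have "\<bar>y b\<bar> \<le> norm (chart \<tau> y - p) * norm b"
        by (metis Cauchy_Schwarz_ineq2)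
      also have "\<dots> \<le> norm (chart \<tau> y) + norm p"
        using norm_triangle_ineq4[of "chart \<tau> y" p] by (simp add: unitB that)
      also have "\<dots> \<le> R" using R0[of "chart \<tau> y"] y by (simp add: R_def S_def)
      finally show ?thesis .
    qed
    then show "y \<in> W" using y by (force simp: W_def S_def space_PiM abs_le_iff PiE_def)
  qed
  have W_finite: "emeasure ?M W < \<infinity>"
  proof -
    have "emeasure ?M W = (\<Prod>b\<in>B. emeasure lborel {-R..R})"
      unfolding W_def by (rule emeasure_PiM[OF finB]) auto
    also have "\<dots> < \<infinity>"
      by (auto simp: emeasure_lborel_Icc_eq ennreal_power[symmetric] power_less_top_ennreal)
    finally show ?thesis .
  qed
  have S_finite: "emeasure ?M (S \<tau>) = ennreal (measure ?M (S \<tau>))" for \<tau>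
    using emeasure_mono[OF S_W W_meas, of \<tau>] W_finite
    by (intro emeasure_eq_ennreal_measure) (auto simp: top_unique)
  define V where "V = (\<lambda>\<tau>. measure ?M (S \<tau>))"
  have AE_interior: "AE y in ?M. chart 0 y \<notin> frontier K"
  proof -
    have "(\<Union>(w, c)\<in>F. {y \<in> space ?M. w \<bullet> chart 0 y = c}) \<in> null_sets ?M"
      using nonparallel by (intro null_sets_UN' countable_finite F) (auto intro!: null_section_of_hyperplane)
    moreover have "{y \<in> space ?M. \<not> chart 0 y \<notin> frontier K} \<subseteq> (\<Union>(w, c)\<in>F. {y \<in> space ?M. w \<bullet> chart 0 y = c})"
      using F(2) by fastforce
    ultimately show ?thesis by (rule AE_I')
  qed
  have V_cont: "isCont V 0"
    unfolding isCont_def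
  proof (rule tendsto_at_iff_sequentially[THEN iffD2], intro allI impI)
    fix u :: "nat \<Rightarrow> real" assume u: "u \<longlonglongrightarrow> 0"
    have V_int: "V \<tau> = integral\<^sup>L ?M (indicator (S \<tau>))" for \<tau>
      using S_meas by (simp add: V_def)
    have "(\<lambda>n. integral\<^sup>L ?M (indicator (S (u n)) :: _ \<Rightarrow> real)) \<longlonglongrightarrow> integral\<^sup>L ?M (indicator (S 0))"
    proof (rule integral_dominated_convergence[where w="indicator W"])
      show "integrable ?M (indicator W :: _ \<Rightarrow> real)"
        using W_finite by (intro integrable_real_indicator) auto
      show "AE y in ?M. (\<lambda>n. indicator (S (u n)) y :: real) \<longlonglongrightarrow> indicator (S 0) y"
        using AE_interior
      proof (rule AE_mp, intro AE_I2 impI)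
        fix y assume y: "y \<in> space ?M" and nf: "chart 0 y \<notin> frontier K"
        have lim: "(\<lambda>n. chart (u n) y) \<longlonglongrightarrow> chart 0 y"
          unfolding chart_def by (intro tendsto_intros u)
        consider "chart 0 y \<in> interior K" | "chart 0 y \<in> - closure K"
          using nf by (auto simp: frontier_def)
        then have "\<forall>\<^sub>F n in sequentially. (indicator (S (u n)) y :: real) = indicator (S 0) y"
        proof cases
          case 1
          then have "\<forall>\<^sub>F n in sequentially. chart (u n) y \<in> interior K"
            using lim open_interior topological_tendstoD by blast
          then show ?thesis
            by eventually_elim (use 1 interior_subset y in \<open>auto simp: S_def indicator_def\<close>)
        next
          case 2
          then have "\<forall>\<^sub>F n in sequentially. chart (u n) y \<in> - closure K"
            using lim open_Compl closed_closure topological_tendstoD by blast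
          then show ?thesis
            by eventually_elim (use 2 closure_subset y in \<open>auto simp: S_def indicator_def\<close>)
        qed
        then show "(\<lambda>n. indicator (S (u n)) y :: real) \<longlonglongrightarrow> indicator (S 0) y"
          by (rule tendsto_eventually)
      qed
      show "AE y in ?M. norm (indicator (S (u n)) y :: real) \<le> indicator W y" for n
        using S_W by (intro AE_I2) (auto simp: indicator_def)
    qed auto
    then show "(V \<circ> u) \<longlonglongrightarrow> V 0" by (simp add: V_int comp_def)
  qed
  define Vol where "Vol = (\<lambda>r. measure lborel {x\<in>K. a \<bullet> x \<le> r})"
  have K_finite: "emeasure lborel K < \<infinity>" using K by (rule emeasure_compact_finite)
  have Vol_slices: "ennreal (Vol (s + h) - Vol s) = (\<integral>\<^sup>+ \<tau>. ennreal (V \<tau>) * indicator {0<..h} \<tau> \<partial>lborel)"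
    if "h > 0" for h
  proof -
    let ?A = "{x\<in>K. a \<bullet> x \<le> s + h} - {x\<in>K. a \<bullet> x \<le> s}"
    have fin: "emeasure lborel {x\<in>K. a \<bullet> x \<le> r} < \<infinity>" for r
      using emeasure_mono[of "{x\<in>K. a \<bullet> x \<le> r}" K lborel] K_finite by (auto simp: less_top[symmetric] top_unique)
    have [measurable]: "{x\<in>K. a \<bullet> x \<le> r} \<in> sets borel" for r by measurable
    have "Vol (s + h) - Vol s = measure lborel ?A"
      unfolding Vol_def using that fin by (intro measure_Diff[symmetric]) (auto simp: less_top)
    moreover have "emeasure lborel ?A = ennreal (measure lborel ?A)"
    proof (rule emeasure_eq_ennreal_measure)
      have "emeasure lborel ?A \<le> emeasure lborel K" by (rule emeasure_mono) auto
      then show "emeasure lborel ?A \<noteq> top" using K_finite by (auto simp: top_unique)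
    qed
    ultimately have "ennreal (Vol (s + h) - Vol s) = emeasure lborel ?A" by simp
    also have "\<dots> = (\<integral>\<^sup>+ \<tau>. emeasure ?M (chart \<tau> -` ?A \<inter> space ?M) \<partial>lborel)"
      by (rule emeasure_lborel_slices) measurable
    also have "\<dots> = (\<integral>\<^sup>+ \<tau>. ennreal (V \<tau>) * indicator {0<..h} \<tau> \<partial>lborel)"
    proof (rule nn_integral_cong)
      fix \<tau> :: real
      have "chart \<tau> -` ?A \<inter> space ?M = (if \<tau> \<in> {0<..h} then S \<tau> else {})"
        by (auto simp: S_def inner_chart)
      then show "emeasure ?M (chart \<tau> -` ?A \<inter> space ?M) = ennreal (V \<tau>) * indicator {0<..h} \<tau>"
        by (simp add: V_def S_finite)
    qed
    finally show ?thesis .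
  qed
  have "((\<lambda>h. (Vol (s + h) - Vol s) / h) \<longlongrightarrow> V 0) (at_right 0)"
  proof (rule tendstoI)
    fix e :: real assume e: "e > 0"
    then obtain \<delta> where \<delta>: "\<delta> > 0" "\<And>\<tau>. \<bar>\<tau>\<bar> < \<delta> \<Longrightarrow> \<bar>V \<tau> - V 0\<bar> < e / 2"
      using V_cont[unfolded continuous_at_eps_delta, rule_format, of "e / 2"] by (auto simp: dist_real_def)
    have "dist ((Vol (s + h) - Vol s) / h) (V 0) < e" if h: "0 < h" "h < \<delta>" for h
    proof -
      have Vol_mono: "Vol s \<le> Vol (s + h)" unfolding Vol_def
        using h K_finite emeasure_mono[of "{x\<in>K. a \<bullet> x \<le> s + h}" K lborel]
        by (intro measure_mono_fmeasurable fmeasurableI) (auto simp: less_top[symmetric] top_unique)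
      have int_const: "(\<integral>\<^sup>+ \<tau>. ennreal c * indicator {0<..h} \<tau> \<partial>lborel) = ennreal (c * h)" if "c \<ge> 0" for c
        using h that by (subst nn_integral_cmult_indicator) (auto simp: ennreal_mult)
      have near: "V \<tau> \<le> V 0 + e / 2 \<and> V 0 - e / 2 \<le> V \<tau>" if "0 < \<tau>" "\<tau> \<le> h" for \<tau>
      proof -
        have "\<bar>V \<tau> - V 0\<bar> < e / 2" using that h by (intro \<delta>) auto
        then show ?thesis by linarith
      qed
      have V0: "V 0 \<ge> 0" by (simp add: V_def)
      have "ennreal (Vol (s + h) - Vol s) \<le> (\<integral>\<^sup>+ \<tau>. ennreal (V 0 + e/2) * indicator {0<..h} \<tau> \<partial>lborel)"
        unfolding Vol_slices[OF h(1)]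
      proof (intro nn_integral_mono)
        fix \<tau>
        show "ennreal (V \<tau>) * indicator {0<..h} \<tau> \<le> ennreal (V 0 + e/2) * indicator {0<..h} \<tau>"
          using near[of \<tau>] h by (auto simp: indicator_def intro!: ennreal_leI)
      qed
      also have "\<dots> = ennreal ((V 0 + e/2) * h)" using V0 e by (intro int_const) simp
      finally have up: "Vol (s + h) - Vol s \<le> (V 0 + e/2) * h"
        using V0 e h by (subst (asm) ennreal_le_iff) auto
      have "(\<integral>\<^sup>+ \<tau>. ennreal (max 0 (V 0 - e/2)) * indicator {0<..h} \<tau> \<partial>lborel) \<le> ennreal (Vol (s + h) - Vol s)"
        unfolding Vol_slices[OF h(1)]
      proof (intro nn_integral_mono)
        fix \<tau>
        have "V \<tau> \<ge> 0" by (simp add: V_def)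
        then show "ennreal (max 0 (V 0 - e/2)) * indicator {0<..h} \<tau> \<le> ennreal (V \<tau>) * indicator {0<..h} \<tau>"
          using near[of \<tau>] h by (auto simp: indicator_def intro!: ennreal_leI)
      qed
      then have "ennreal (max 0 (V 0 - e/2) * h) \<le> ennreal (Vol (s + h) - Vol s)"
        by (subst (asm) int_const) auto
      then have "max 0 (V 0 - e/2) * h \<le> Vol (s + h) - Vol s"
        using Vol_mono by (subst (asm) ennreal_le_iff) auto
      moreover have "(V 0 - e/2) * h \<le> max 0 (V 0 - e/2) * h" using h by (intro mult_right_mono) auto
      ultimately have low: "(V 0 - e/2) * h \<le> Vol (s + h) - Vol s" by linarith
      have "(Vol (s + h) - Vol s) / h \<le> V 0 + e/2" "V 0 - e/2 \<le> (Vol (s + h) - Vol s) / h"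
        using up low h by (simp_all add: pos_divide_le_eq pos_le_divide_eq)
      then show ?thesis using e by (simp add: dist_real_def abs_less_iff)
    qed
    then show "\<forall>\<^sub>F h in at_right 0. dist ((Vol (s + h) - Vol s) / h) (V 0) < e"
      using \<delta>(1) by (auto simp: eventually_at_right)
  qed
  moreover have "((\<lambda>h. (Vol (s + h) - Vol s) / h) \<longlongrightarrow> G) (at_right 0)"
    using deriv unfolding DERIV_def Vol_def
    by (rule tendsto_within_subset) auto
  ultimately have "V 0 = G" by (rule tendsto_unique[rotated]) simp
  then show ?thesis by (simp add: V_def S_def)
qed

end

section \<open>The volume of the cube on one side of a hyperplane\<close>

text \<open>The truncated power \<open>x\<^sub>+\<^sup>m / m!\<close>.  The case \<open>m = 0\<close> is the indicator function of \<open>[0, \<infinity>)\<close>, which a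
definition by \<open>(max 0 x) ^ m\<close> would miss.\<close>
definition tpow :: "nat \<Rightarrow> real \<Rightarrow> real" where
  "tpow m x = (if x < 0 then 0 else x ^ m / fact m)"

lemma tpow_0: "x \<le> 0 \<Longrightarrow> tpow (Suc m) x = 0" by (auto simp: tpow_def)

lemma continuous_tpow_Suc: "continuous_on UNIV (tpow (Suc m))"
proof -
  have "tpow (Suc m) = (\<lambda>x. (max 0 x) ^ Suc m / fact (Suc m))"
    by (auto simp: tpow_def max_def fun_eq_iff)
  then show ?thesis by (simp only:) (intro continuous_intros; simp)
qed

lemma tpow_Suc_deriv:
  assumes "x \<noteq> 0 \<or> m \<noteq> 0"
  shows "(tpow (Suc m) has_real_derivative tpow m x) (at x)"
proof -
  have pow: "((\<lambda>x. x ^ Suc m / fact (Suc m)) has_real_derivative x ^ m / fact m) (at x)" for x :: real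
  proof -
    have "((\<lambda>x. x ^ Suc m / fact (Suc m)) has_real_derivative (real (Suc m) * x ^ m) / fact (Suc m)) (at x)"
      using DERIV_cdivide[OF DERIV_pow[of "Suc m" x UNIV], of "fact (Suc m)"]
      by (simp del: of_nat_Suc fact_Suc power_Suc)
    then show ?thesis by (simp add: fact_Suc del: of_nat_Suc)
  qed
  consider "x < 0" | "x > 0" | "x = 0" "m \<noteq> 0" using assms by fastforce
  then show ?thesis
  proof cases
    case 1
    then have "\<forall>\<^sub>F y in nhds x. tpow (Suc m) y = 0"
      by (intro eventually_mono[OF eventually_nhds_in_open[of "{..<0}"]]) (auto simp: tpow_def)
    then have "(tpow (Suc m) has_real_derivative 0) (at x)"
      by (subst DERIV_cong_ev[OF refl _ refl]) auto
    then show ?thesis using 1 by (simp add: tpow_def)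
  next
    case 2
    then have "\<forall>\<^sub>F y in nhds x. tpow (Suc m) y = y ^ Suc m / fact (Suc m)"
      by (intro eventually_mono[OF eventually_nhds_in_open[of "{0<..}"]]) (auto simp: tpow_def)
    then have "(tpow (Suc m) has_real_derivative x ^ m / fact m) (at x)"
      by (subst DERIV_cong_ev[OF refl _ refl]) (use pow in auto)
    then show ?thesis using 2 by (simp add: tpow_def)
  next
    case 3
    have "((\<lambda>h. tpow (Suc m) h / h) \<longlongrightarrow> 0) (at 0)"
    proof (rule Lim_null_comparison)
      show "\<forall>\<^sub>F h in at 0. norm (tpow (Suc m) h / h) \<le> \<bar>h ^ m / fact (Suc m)\<bar>"
      proof (intro always_eventually allI)
        fix h :: real
        show "norm (tpow (Suc m) h / h) \<le> \<bar>h ^ m / fact (Suc m)\<bar>"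
          by (cases "h > 0") (auto simp: tpow_def abs_mult)
      qed
      have "((\<lambda>h. \<bar>h ^ m / fact (Suc m)\<bar>) \<longlongrightarrow> \<bar>0 ^ m / fact (Suc m)\<bar>) (at (0::real))"
        by (intro tendsto_intros) simp
      then show "((\<lambda>h. \<bar>h ^ m / fact (Suc m)\<bar>) \<longlongrightarrow> 0) (at (0::real))" using 3 by (simp add: power_0_left)
    qed
    then show ?thesis using 3 by (simp add: DERIV_def tpow_0 power_0_left) (simp add: tpow_def power_0_left)
  qed
qed

lemma tpow_has_integral:
  assumes "c \<noteq> 0"
  shows "((\<lambda>\<tau>. tpow m (w - c * (\<tau> - 1/2))) has_integral
           (tpow (Suc m) (w + \<bar>c\<bar> / 2) - tpow (Suc m) (w - \<bar>c\<bar> / 2)) / \<bar>c\<bar>) {0..1}"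
proof -
  let ?g = "\<lambda>\<tau>. - tpow (Suc m) (w - c * (\<tau> - 1/2)) / c"
  have "((\<lambda>\<tau>. tpow m (w - c * (\<tau> - 1/2))) has_integral (?g 1 - ?g 0)) {0..1}"
  proof (rule fundamental_theorem_of_calculus_interior_strong)
    show "finite {\<tau>. w - c * (\<tau> - 1/2) = 0}"
      by (rule finite_subset[of _ "{w / c + 1/2}"]) (use assms in \<open>auto simp: field_simps\<close>)
    fix \<tau> assume "\<tau> \<in> {0<..<1} - {\<tau>. w - c * (\<tau> - 1/2) = 0}"
    then have "(tpow (Suc m) has_real_derivative tpow m (w - c * (\<tau> - 1/2))) (at (w - c * (\<tau> - 1/2)))"
      by (intro tpow_Suc_deriv) auto
    then have "(?g has_real_derivative tpow m (w - c * (\<tau> - 1/2))) (at \<tau>)"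
      using assms by (auto intro!: derivative_eq_intros DERIV_chain2[where f="tpow (Suc m)"])
    then show "(?g has_vector_derivative tpow m (w - c * (\<tau> - 1/2))) (at \<tau>)"
      by (simp add: has_real_derivative_iff_has_vector_derivative)
  next
    show "continuous_on {0..1} ?g"
      by (intro continuous_intros continuous_on_compose2[OF continuous_tpow_Suc]) (use assms in auto)
  qed simp
  moreover have "?g 1 - ?g 0 = (tpow (Suc m) (w + \<bar>c\<bar> / 2) - tpow (Suc m) (w - \<bar>c\<bar> / 2)) / \<bar>c\<bar>"
    using assms by (cases "c > 0") (auto simp: field_simps)
  ultimately show ?thesis by simp
qed

text \<open>For \<open>m = |J|\<close> this is the numerator of the volume of the part of the cube \<open>[0, 1]\<^sup>J\<close> where the
linear form with coefficients \<open>c\<close> exceeds its value at the centre by at most \<open>v\<close>; for \<open>m = |J| - 1\<close>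
it is the numerator of the derivative in \<open>v\<close>.  Measuring from the centre makes the expression even
in each \<open>c j\<close>, so that vectors in all orthants are treated at once.\<close>
definition halfspace_num :: "'i set \<Rightarrow> ('i \<Rightarrow> real) \<Rightarrow> nat \<Rightarrow> real \<Rightarrow> real" where
  "halfspace_num J c m v =
     (\<Sum>K\<in>Pow J. (-1) ^ card K * tpow m (v + (\<Sum>j\<in>J. \<bar>c j\<bar>) / 2 - (\<Sum>j\<in>K. \<bar>c j\<bar>)))"

lemma sum_Pow_insert:
  assumes "finite J" "j \<notin> J"
  shows "(\<Sum>K\<in>Pow (insert j J). f K) = (\<Sum>K\<in>Pow J. f K + f (insert j K))"
proof -
  have "inj_on (insert j) (Pow J)"
    using assms(2) by (auto simp: inj_on_def)
  moreover have "Pow J \<inter> insert j ` Pow J = {}" using assms(2) by auto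
  ultimately show ?thesis
    using assms(1) by (simp add: Pow_insert sum.union_disjoint sum.reindex sum.distrib)
qed

lemma halfspace_num_insert:
  assumes "finite J" "j \<notin> J"
  shows "halfspace_num (insert j J) c m v = halfspace_num J c m (v + \<bar>c j\<bar> / 2) - halfspace_num J c m (v - \<bar>c j\<bar> / 2)"
proof -
  have "K \<subseteq> J \<Longrightarrow> card (insert j K) = Suc (card K)" for K
    using assms finite_subset[of K J] by (subst card_insert_disjoint) auto
  moreover have "K \<subseteq> J \<Longrightarrow> (\<Sum>i\<in>insert j K. \<bar>c i\<bar>) = \<bar>c j\<bar> + (\<Sum>i\<in>K. \<bar>c i\<bar>)" for K
    using assms finite_subset[of K J] by (subst sum.insert) auto
  ultimately show ?thesis using assms
    unfolding halfspace_num_def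
    by (simp add: sum_Pow_insert sum_subtractf[symmetric] algebra_simps add_divide_distrib)
qed

text \<open>Integrating out the coordinate \<open>j\<close> raises the degree by one and takes a difference of step
\<open>\<bar>c j\<bar>\<close>, which is the recursion that \<open>halfspace_num\<close> satisfies.\<close>
lemma halfspace_num_integral:
  assumes J: "finite J" "j \<notin> J" and c: "c j \<noteq> 0"
  shows "((\<lambda>\<tau>. halfspace_num J c m (v - c j * (\<tau> - 1/2))) has_integral
           halfspace_num (insert j J) c (Suc m) v / \<bar>c j\<bar>) {0..1}"
proof -
  let ?w = "\<lambda>K. v + (\<Sum>j\<in>J. \<bar>c j\<bar>) / 2 - (\<Sum>j\<in>K. \<bar>c j\<bar>)"
  have "((\<lambda>\<tau>. \<Sum>K\<in>Pow J. (-1) ^ card K * tpow m (?w K - c j * (\<tau> - 1/2))) has_integral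
      (\<Sum>K\<in>Pow J. (-1) ^ card K * ((tpow (Suc m) (?w K + \<bar>c j\<bar> / 2) - tpow (Suc m) (?w K - \<bar>c j\<bar> / 2)) / \<bar>c j\<bar>))) {0..1}"
    using J c by (intro has_integral_sum has_integral_mult_right tpow_has_integral) auto
  also have "(\<lambda>\<tau>. \<Sum>K\<in>Pow J. (-1) ^ card K * tpow m (?w K - c j * (\<tau> - 1/2)))
      = (\<lambda>\<tau>. halfspace_num J c m (v - c j * (\<tau> - 1/2)))"
    by (simp add: halfspace_num_def algebra_simps)
  also have "(\<Sum>K\<in>Pow J. (-1) ^ card K * ((tpow (Suc m) (?w K + \<bar>c j\<bar> / 2) - tpow (Suc m) (?w K - \<bar>c j\<bar> / 2)) / \<bar>c j\<bar>))
      = halfspace_num (insert j J) c (Suc m) v / \<bar>c j\<bar>"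
    by (subst halfspace_num_insert[OF J])
       (simp add: halfspace_num_def sum_subtractf[symmetric] sum_divide_distrib algebra_simps diff_divide_distrib)
  finally show ?thesis .
qed

lemma halfspace_PiM:
  assumes "finite J" "\<And>j. j \<in> J \<Longrightarrow> c j \<noteq> 0"
  shows "0 \<le> halfspace_num J c (card J) v / (\<Prod>j\<in>J. \<bar>c j\<bar>) \<and>
    emeasure (\<Pi>\<^sub>M j\<in>J. (lborel :: real measure))
      {x \<in> space (\<Pi>\<^sub>M j\<in>J. lborel). (\<forall>j\<in>J. x j \<in> {0..1}) \<and> (\<Sum>j\<in>J. c j * (x j - 1/2)) \<le> v}
    = ennreal (halfspace_num J c (card J) v / (\<Prod>j\<in>J. \<bar>c j\<bar>))"
  using assms
proof (induction J arbitrary: v rule: finite_induct)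
  case empty
  have "{x \<in> space (\<Pi>\<^sub>M j\<in>{}. lborel). (\<forall>j\<in>{}. x j \<in> {0..1}) \<and> (\<Sum>j\<in>{}. c j * (x j - 1/2)) \<le> v}
      = (if v < 0 then {} else {\<lambda>_. undefined})"
    by (auto simp: space_PiM)
  then show ?case by (simp add: halfspace_num_def tpow_def)
next
  case (insert j J)
  interpret product_sigma_finite "\<lambda>_::'a. lborel :: real measure"
    by standard
  let ?M = "\<lambda>I::'a set. \<Pi>\<^sub>M j\<in>I. (lborel :: real measure)"
  let ?A = "\<lambda>I v. {x \<in> space (?M I). (\<forall>j\<in>I. x j \<in> {0..1}) \<and> (\<Sum>j\<in>I. c j * (x j - 1/2)) \<le> v}"
  let ?F = "\<lambda>I v. halfspace_num I c (card I) v / (\<Prod>j\<in>I. \<bar>c j\<bar>)"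
  have IH: "0 \<le> ?F J v" "emeasure (?M J) (?A J v) = ennreal (?F J v)" for v
    using insert.IH insert.prems by auto
  have A_meas [measurable]: "?A I v \<in> sets (?M I)" if "finite I" for I v
    using that by measurable
  have "((\<lambda>\<tau>. halfspace_num J c (card J) (v - c j * (\<tau> - 1/2)) / (\<Prod>j\<in>J. \<bar>c j\<bar>)) has_integral
      halfspace_num (insert j J) c (Suc (card J)) v / \<bar>c j\<bar> / (\<Prod>j\<in>J. \<bar>c j\<bar>)) {0..1}"
    using insert by (intro has_integral_divide halfspace_num_integral) auto
  then have int: "((\<lambda>\<tau>. ?F J (v - c j * (\<tau> - 1/2))) has_integral ?F (insert j J) v) {0..1}"
    using insert by simp
  have nonneg: "0 \<le> ?F (insert j J) v"
    by (rule has_integral_nonneg[OF int]) (rule IH)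
  have "emeasure (?M (insert j J)) (?A (insert j J) v) = (\<integral>\<^sup>+ x. indicator (?A (insert j J) v) x \<partial>?M (insert j J))"
    using insert A_meas by simp
  also have "\<dots> = (\<integral>\<^sup>+ \<tau>. \<integral>\<^sup>+ x. indicator (?A (insert j J) v) (x(j := \<tau>)) \<partial>?M J \<partial>lborel)"
    using insert A_meas by (intro product_nn_integral_insert_rev) auto
  also have "\<dots> = (\<integral>\<^sup>+ \<tau>. emeasure (?M J) (?A J (v - c j * (\<tau> - 1/2))) * indicator {0..1} \<tau> \<partial>lborel)"
  proof (intro nn_integral_cong)
    fix \<tau> :: real
    have "indicator (?A (insert j J) v) (x(j := \<tau>)) = 
        (indicator (?A J (v - c j * (\<tau> - 1/2))) x * indicator {0..1} \<tau> :: ennreal)" if x: "x \<in> space (?M J)" for x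
    proof -
      have "x(j := \<tau>) \<in> space (?M (insert j J))" using x by (auto simp: space_PiM PiE_def extensional_def)
      moreover have "(\<Sum>i\<in>J. c i * ((x(j := \<tau>)) i - 1/2)) = (\<Sum>i\<in>J. c i * (x i - 1/2))"
        using insert.hyps by (intro sum.cong) auto
      moreover have "(\<forall>i\<in>J. (x(j := \<tau>)) i \<in> {0..1}) = (\<forall>i\<in>J. x i \<in> {0..1})"
        using insert.hyps by (intro ball_cong) auto
      ultimately show ?thesis
        using x insert.hyps by (auto simp: indicator_def algebra_simps)
    qed
    then have "(\<integral>\<^sup>+ x. indicator (?A (insert j J) v) (x(j := \<tau>)) \<partial>?M J)
       = (\<integral>\<^sup>+ x. indicator (?A J (v - c j * (\<tau> - 1/2))) x * indicator {0..1} \<tau> \<partial>?M J)"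
      by (intro nn_integral_cong) auto
    also have "\<dots> = emeasure (?M J) (?A J (v - c j * (\<tau> - 1/2))) * indicator {0..1} \<tau>"
      using insert.hyps by (subst nn_integral_multc) (auto intro!: A_meas)
    finally show "(\<integral>\<^sup>+ x. indicator (?A (insert j J) v) (x(j := \<tau>)) \<partial>?M J)
       = emeasure (?M J) (?A J (v - c j * (\<tau> - 1/2))) * indicator {0..1} \<tau>" .
  qed
  also have "\<dots> = (\<integral>\<^sup>+ \<tau>. ennreal (?F J (v - c j * (\<tau> - 1/2))) * indicator {0..1} \<tau> \<partial>lborel)"
    by (simp only: IH)
  also have "\<dots> = ennreal (?F (insert j J) v)"
    by (rule nn_integral_has_integral_lebesgue'[OF _ int]) (rule IH)
  finally show ?case using nonneg by blast
qed

lemma halfspace_num_deriv: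
  "(halfspace_num J c (Suc (Suc m)) has_real_derivative halfspace_num J c (Suc m) v) (at v)"
proof -
  have "((\<lambda>v. \<Sum>K\<in>Pow J. (-1) ^ card K * tpow (Suc (Suc m)) (v + ((\<Sum>j\<in>J. \<bar>c j\<bar>) / 2 - (\<Sum>j\<in>K. \<bar>c j\<bar>))))
     has_real_derivative (\<Sum>K\<in>Pow J. (-1) ^ card K * tpow (Suc m) (v + ((\<Sum>j\<in>J. \<bar>c j\<bar>) / 2 - (\<Sum>j\<in>K. \<bar>c j\<bar>))))) (at v)"
    by (intro DERIV_sum DERIV_cmult, subst DERIV_shift[symmetric]) (simp add: tpow_Suc_deriv)
  then show ?thesis by (simp add: halfspace_num_def[abs_def] algebra_simps)
qed

section \<open>Irwin-Hall densities\<close>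

text \<open>Iterated backward differences of step one.  The alternating sums over subsets that occur in the
volume formula collapse to them as soon as all coefficients are equal.\<close>
primrec bdiff :: "nat \<Rightarrow> (real \<Rightarrow> real) \<Rightarrow> real \<Rightarrow> real" where
  "bdiff 0 f x = f x"
| "bdiff (Suc n) f x = bdiff n f x - bdiff n f (x - 1)"

text \<open>The density of a sum of \<open>n \<ge> 1\<close> independent random variables uniform on \<open>[0, 1]\<close>.\<close>
definition irwin_hall :: "nat \<Rightarrow> real \<Rightarrow> real" where
  "irwin_hall n x = bdiff n (tpow (n - 1)) x"

lemma sum_Pow_bdiff:
  assumes "finite J"
  shows "(\<Sum>K\<in>Pow J. (-1) ^ card K * f (x - real (card K))) = bdiff (card J) f x"
  using assms
proof (induction J arbitrary: x rule: finite_induct)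
  case (insert j J)
  have "K \<subseteq> J \<Longrightarrow> card (insert j K) = Suc (card K)" for K
    using insert.hyps finite_subset[of K J] by (subst card_insert_disjoint) auto
  then have "(\<Sum>K\<in>Pow (insert j J). (-1) ^ card K * f (x - real (card K)))
      = (\<Sum>K\<in>Pow J. (-1) ^ card K * f (x - real (card K))) - (\<Sum>K\<in>Pow J. (-1) ^ card K * f (x - 1 - real (card K)))"
    using insert.hyps by (simp add: sum_Pow_insert sum_subtractf[symmetric] algebra_simps)
  then show ?case using insert by simp
qed simp

lemma bdiff_neg: "x < 0 \<Longrightarrow> bdiff n (tpow m) x = 0"
  by (induction n arbitrary: x) (auto simp: tpow_def)

lemma bdiff_deriv:
  "(bdiff n (tpow (Suc (Suc m))) has_real_derivative bdiff n (tpow (Suc m)) x) (at x)"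
proof (induction n arbitrary: x)
  case 0
  have "bdiff 0 f = f" for f by (rule ext) simp
  then show ?case using tpow_Suc_deriv[of x "Suc m"] by simp
next
  case (Suc n)
  have "((\<lambda>x. bdiff n (tpow (Suc (Suc m))) (x - 1)) has_real_derivative bdiff n (tpow (Suc m)) (x - 1)) (at x)"
    using Suc.IH[of "x + - 1"] DERIV_shift[of "bdiff n (tpow (Suc (Suc m)))" _ x "- 1"] by simp
  then have "((\<lambda>x. bdiff n (tpow (Suc (Suc m))) x - bdiff n (tpow (Suc (Suc m))) (x - 1)) has_real_derivative
     bdiff n (tpow (Suc m)) x - bdiff n (tpow (Suc m)) (x - 1)) (at x)"
    by (intro DERIV_diff Suc.IH)
  moreover have "bdiff (Suc n) f = (\<lambda>x. bdiff n f x - bdiff n f (x - 1))" for f by (rule ext) simp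
  ultimately show ?case by simp
qed

text \<open>From \<open>x \<cdot> x\<^sub>+\<^sup>m / m! = (m + 1) x\<^sub>+\<^bsup>m+1\<^esup> / (m + 1)!\<close> and the product rule for differences.  It is the
source of the three-term recursion of the densities.\<close>
lemma bdiff_mult:
  "x * bdiff n (tpow m) x = real (Suc m) * bdiff n (tpow (Suc m)) x - real n * bdiff (n - 1) (tpow m) (x - 1)"
proof (induction n arbitrary: x)
  case 0
  have "real (Suc m) * (x ^ Suc m / fact (Suc m)) = x * (x ^ m / fact m)"
    by (simp add: fact_Suc field_simps del: of_nat_Suc)
  then show ?case by (simp add: tpow_def del: of_nat_Suc power_Suc fact_Suc)
next
  case (Suc n)
  let ?u = "\<lambda>n m. bdiff n (tpow m)"
  have step: "real n * (?u (n - 1) m (x - 1) - ?u (n - 1) m (x - 2)) = real n * ?u n m (x - 1)"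
    by (cases n) (simp_all add: algebra_simps)
  have "x * ?u (Suc n) m x = x * ?u n m x - (x - 1) * ?u n m (x - 1) - ?u n m (x - 1)"
    by (simp add: algebra_simps)
  also have "\<dots> = real (Suc m) * ?u (Suc n) (Suc m) x
      - real n * (?u (n - 1) m (x - 1) - ?u (n - 1) m (x - 2)) - ?u n m (x - 1)"
    unfolding Suc.IH[of x] Suc.IH[of "x - 1"] by (simp add: algebra_simps)
  also have "\<dots> = real (Suc m) * ?u (Suc n) (Suc m) x - real (Suc n) * ?u n m (x - 1)"
    unfolding step by (simp add: algebra_simps)
  finally show ?case by simp
qed

lemma irwin_hall_rec:
  assumes "n \<ge> 1"
  shows "real n * irwin_hall (Suc n) x = x * irwin_hall n x + (real n + 1 - x) * irwin_hall n (x - 1)"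
proof -
  obtain m where m: "n = Suc m" using assms by (cases n) auto
  show ?thesis
    using bdiff_mult[of x "Suc n" m] by (simp add: irwin_hall_def m algebra_simps)
qed

lemma irwin_hall_neg: "x < 0 \<Longrightarrow> irwin_hall n x = 0"
  by (simp add: irwin_hall_def bdiff_neg)

lemma irwin_hall_nonneg: "n \<ge> 1 \<Longrightarrow> 0 \<le> irwin_hall n x \<and> (real n < x \<longrightarrow> irwin_hall n x = 0)"
proof (induction n arbitrary: x rule: nat_induct_at_least)
  case base
  show ?case by (simp add: irwin_hall_def tpow_def)
next
  case (Suc n)
  note rec = irwin_hall_rec[OF Suc.hyps, of x]
  have n: "real n > 0" using Suc.hyps by simp
  consider "x < 0" | "0 \<le> x" "x \<le> real n + 1" | "real n + 1 < x" by linarith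
  then show ?case
  proof cases
    case 1 then show ?thesis by (simp add: irwin_hall_neg)
  next
    case 2
    then have "0 \<le> real n * irwin_hall (Suc n) x"
      using rec Suc.IH by simp
    then show ?thesis using n 2 by (simp add: zero_le_mult_iff)
  next
    case 3
    then have "real n * irwin_hall (Suc n) x = 0" using rec Suc.IH[of x] Suc.IH[of "x - 1"] by simp
    then show ?thesis using n by simp
  qed
qed

lemma irwin_hall_pos:
  assumes "n \<ge> 1" "0 < x" "x < real n"
  shows "0 < irwin_hall n x"
  using assms
proof (induction n arbitrary: x rule: nat_induct_at_least)
  case base
  then show ?case by (simp add: irwin_hall_def tpow_def)
next
  case (Suc n)
  note rec = irwin_hall_rec[OF Suc.hyps, of x]
  have nn: "0 \<le> irwin_hall n y" for y using irwin_hall_nonneg Suc.hyps by blast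
  have "0 < x * irwin_hall n x + (real n + 1 - x) * irwin_hall n (x - 1)"
  proof (cases "x < real n")
    case True
    then have "0 < x * irwin_hall n x" using Suc by simp
    moreover have "0 \<le> (real n + 1 - x) * irwin_hall n (x - 1)" using nn True by simp
    ultimately show ?thesis by linarith
  next
    case False
    show ?thesis
    proof (cases "x = 1")
      case True
      then have "n = 1" using False Suc.hyps by simp
      then show ?thesis using True by (simp add: irwin_hall_def tpow_def)
    next
      case ne: False
      have "0 < (real n + 1 - x) * irwin_hall n (x - 1)"
        using False ne Suc.prems Suc.hyps by (intro mult_pos_pos Suc.IH) auto
      moreover have "0 \<le> x * irwin_hall n x" using nn Suc.prems by simp
      ultimately show ?thesis by linarith
    qed
  qed
  then have "0 < real n * irwin_hall (Suc n) x" using rec by simp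
  then show ?case using Suc.hyps by (simp add: zero_less_mult_iff)
qed

lemma irwin_hall_2: "irwin_hall 2 x = max 0 (1 - \<bar>x - 1\<bar>)"
  by (simp add: irwin_hall_def numeral_2_eq_2 tpow_def max_def abs_if)

lemma irwin_hall_symmetric:
  assumes "n \<ge> 2"
  shows "irwin_hall n (real n - x) = irwin_hall n x"
  using assms
proof (induction n arbitrary: x rule: nat_induct_at_least)
  case base
  show ?case by (simp add: irwin_hall_2 abs_minus_commute)
next
  case (Suc n)
  have n: "n \<ge> 1" "real n \<noteq> 0" using Suc.hyps by auto
  have eq: "real (Suc n) - x = real n - (x - 1)" "real n - (x - 1) - 1 = real n - x" by simp_all
  have "real n * irwin_hall (Suc n) (real (Suc n) - x) = real n * irwin_hall (Suc n) x"
    unfolding irwin_hall_rec[OF n(1)] eq Suc.IH by (simp add: algebra_simps)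
  then show ?case using n by simp
qed

lemma irwin_hall_deriv:
  assumes "n \<ge> 2"
  shows "(irwin_hall (Suc n) has_real_derivative irwin_hall n x - irwin_hall n (x - 1)) (at x)"
proof -
  obtain m where m: "n = Suc (Suc m)" using assms by (cases n; cases "n - 1") auto
  show ?thesis using bdiff_deriv[of "Suc n" m x] unfolding irwin_hall_def m by simp
qed

text \<open>Unimodality: the derivative of the next density at \<open>z\<close> is \<open>p\<^sub>n(z) - p\<^sub>n(z - 1)\<close>, and for \<open>z\<close> left of
the next mode \<open>(n + 1) / 2\<close> the point \<open>z\<close> is closer to \<open>n / 2\<close> than \<open>z - 1\<close>.\<close>
lemma irwin_hall_mono:
  assumes "n \<ge> 2" "x \<le> y" "y \<le> real n / 2"
  shows "irwin_hall n x \<le> irwin_hall n y"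
  using assms
proof (induction n arbitrary: x y rule: nat_induct_at_least)
  case base
  then show ?case by (auto simp: irwin_hall_2 max_def abs_if)
next
  case (Suc n)
  show ?case
  proof (rule DERIV_nonneg_imp_nondecreasing[OF Suc.prems(1)], intro exI conjI)
    fix z assume z: "x \<le> z" "z \<le> y"
    show "(irwin_hall (Suc n) has_real_derivative irwin_hall n z - irwin_hall n (z - 1)) (at z)"
      using Suc.hyps by (rule irwin_hall_deriv)
    have zn: "z \<le> (real n + 1) / 2" using z Suc.prems by simp
    show "0 \<le> irwin_hall n z - irwin_hall n (z - 1)"
    proof (cases "z \<le> real n / 2")
      case True
      then show ?thesis using Suc.IH[of "z - 1" z] by simp
    next
      case False
      then have "irwin_hall n (z - 1) \<le> irwin_hall n (real n - z)"
        using zn by (intro Suc.IH) auto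
      then show ?thesis by (simp add: irwin_hall_symmetric[OF Suc.hyps])
    qed
  qed
qed

lemma irwin_hall_shift_le:
  assumes "n \<ge> 2" "x \<le> (real n + 1) / 2"
  shows "irwin_hall n (x - 1) \<le> irwin_hall n x"
proof (cases "x \<le> real n / 2")
  case True
  then show ?thesis using assms by (intro irwin_hall_mono) auto
next
  case False
  then have "irwin_hall n (x - 1) \<le> irwin_hall n (real n - x)"
    using assms by (intro irwin_hall_mono) auto
  then show ?thesis by (simp add: irwin_hall_symmetric assms)
qed

text \<open>Left of the mode the densities grow at least as fast as this.  Expanding both sides by the
recursion in terms of \<open>p\<^sub>n\<close> at \<open>x\<close>, \<open>x - 1\<close> and \<open>x - 2\<close>, the induction hypothesis bounds the
ratios of neighbouring values.  The hypothesis at \<open>x\<close> is only available up to \<open>n / 2\<close>, so the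
remaining interval up to \<open>(n + 1) / 2\<close> uses unimodality.\<close>
lemma irwin_hall_ratio:
  assumes "n \<ge> 2" "0 \<le> x" "x \<le> real n / 2"
  shows "(real n - x) * irwin_hall n (x - 1) \<le> x * irwin_hall n x"
  using assms
proof (induction n arbitrary: x rule: nat_induct_at_least)
  case base
  then show ?case by (simp add: irwin_hall_2)
next
  case (Suc n)
  define P0 P1 P2 where "P0 = irwin_hall n x" "P1 = irwin_hall n (x - 1)" "P2 = irwin_hall n (x - 2)"
  have n: "real n \<ge> 2" using Suc.hyps by simp
  have nn: "0 \<le> irwin_hall n y" for y using irwin_hall_nonneg Suc.hyps by simp
  have P: "0 \<le> P0" "0 \<le> P1" "0 \<le> P2" by (simp_all add: P0_P1_P2_def nn)
  show ?case
  proof (cases "x < 1")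
    case True
    then show ?thesis using Suc.prems irwin_hall_nonneg[of "Suc n" x] by (simp add: irwin_hall_neg)
  next
    case False
    have x: "1 \<le> x" "x \<le> (real n + 1) / 2" using False Suc.prems by auto
    let ?z = "real n + 1 - x"
    have "(real n - (x - 1)) * irwin_hall n (x - 1 - 1) \<le> (x - 1) * irwin_hall n (x - 1)"
      using x by (intro Suc.IH) auto
    then have IH1: "?z * P2 \<le> (x - 1) * P1" by (simp add: P0_P1_P2_def algebra_simps)
    have rec0: "real n * irwin_hall (Suc n) x = x * P0 + ?z * P1"
      using irwin_hall_rec[of n x] Suc.hyps by (simp add: P0_P1_P2_def)
    have rec1: "real n * irwin_hall (Suc n) (x - 1) = (x - 1) * P1 + (?z + 1) * P2"
      using irwin_hall_rec[of n "x - 1"] Suc.hyps by (simp add: P0_P1_P2_def algebra_simps)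
    have z: "?z \<ge> x" "?z > 0" using x n by auto
    \<comment> \<open>after multiplication by \<open>n\<close>, a multiple of \<open>P1\<close> separates the two sides of the claim\<close>
    have up: "?z * (real n * irwin_hall (Suc n) (x - 1)) \<le> (x - 1) * (2 * ?z + 1) * P1"
    proof -
      have "?z * (real n * irwin_hall (Suc n) (x - 1)) = ?z * (x - 1) * P1 + (?z + 1) * (?z * P2)"
        unfolding rec1 by (simp add: algebra_simps)
      also have "\<dots> \<le> ?z * (x - 1) * P1 + (?z + 1) * ((x - 1) * P1)"
        using z IH1 by (intro add_left_mono mult_left_mono) auto
      finally show ?thesis by (simp add: algebra_simps)
    qed
    have low: "(x - 1) * (2 * ?z + 1) * P1 \<le> x * (x * P0 + ?z * P1)"
    proof (cases "x \<le> real n / 2")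
      case True
      then have "(real n - x) * P1 \<le> x * P0"
        using x Suc.IH[of x] by (simp add: P0_P1_P2_def)
      then have "x * ((real n - x) * P1 + ?z * P1) \<le> x * (x * P0 + ?z * P1)"
        using x by (intro mult_left_mono add_right_mono) auto
      moreover have "(x - 1) * (2 * ?z + 1) \<le> x * ((real n - x) + ?z)"
        using x by (simp add: algebra_simps)
      then have "(x - 1) * (2 * ?z + 1) * P1 \<le> x * ((real n - x) + ?z) * P1"
        using P by (intro mult_right_mono) auto
      ultimately show ?thesis by (simp add: algebra_simps)
    next
      case False
      have "P1 \<le> P0" unfolding P0_P1_P2_def
        using Suc.hyps x by (intro irwin_hall_shift_le) auto
      then have "x * (x * P1 + ?z * P1) \<le> x * (x * P0 + ?z * P1)"
        using x by (intro mult_left_mono add_right_mono) auto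
      moreover have "(x - 1) * (2 * ?z + 1) \<le> x * (x + ?z)"
      proof -
        \<comment> \<open>the excess of \<open>2 x\<close> over \<open>n\<close>, which lies in \<open>[0, 1]\<close> on the remaining interval\<close>
        define e where "e = 2 * x - real n"
        have e: "0 \<le> e" "e \<le> 1" using False x by (auto simp: e_def)
        have eq: "x * (x + ?z) - (x - 1) * (2 * ?z + 1) = (real n * e + e\<^sup>2) / 2 + (3 - 2 * e)"
          by (simp add: e_def field_simps power2_eq_square)
        have "0 \<le> x * (x + ?z) - (x - 1) * (2 * ?z + 1)"
          unfolding eq using e n by (intro add_nonneg_nonneg) auto
        then show ?thesis by (simp only: diff_ge_0_iff_ge)
      qed
      then have "(x - 1) * (2 * ?z + 1) * P1 \<le> x * (x + ?z) * P1"
        using P by (intro mult_right_mono) auto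
      ultimately show ?thesis by (simp add: algebra_simps)
    qed
    have "real n * (?z * irwin_hall (Suc n) (x - 1)) \<le> real n * (x * irwin_hall (Suc n) x)"
      using up low rec0 by (simp add: mult.left_commute)
    then have "?z * irwin_hall (Suc n) (x - 1) \<le> x * irwin_hall (Suc n) x"
      using n by (simp add: mult_le_cancel_left_pos)
    then show ?thesis by (simp add: algebra_simps)
  qed
qed

text \<open>With \<open>d = m + 4\<close>, this says that the quadratic term of the section volume at the diagonal is
negative.  Eliminating the left-hand side by the recursion leaves a combination of differences
that the ratio bound controls.\<close>
lemma irwin_hall_curvature:
  assumes \<sigma>: "0 < \<sigma>" "\<sigma> < (real m + 3) / 4"
  shows "4 * irwin_hall (m + 4) \<sigma>
     < irwin_hall (m + 3) \<sigma> + irwin_hall (m + 3) (\<sigma> - 1) + 2 * irwin_hall (m + 2) (\<sigma> - 1)"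
proof -
  define p A B E where "p = irwin_hall (m + 4) \<sigma>" and "A = irwin_hall (m + 3) \<sigma>"
    and "B = irwin_hall (m + 3) (\<sigma> - 1)" and "E = irwin_hall (m + 2) (\<sigma> - 1)"
  have rec: "(real m + 3) * p = \<sigma> * A + (real m + 4 - \<sigma>) * B"
    using irwin_hall_rec[of "m + 3" \<sigma>] by (simp add: p_def A_def B_def eval_nat_numeral algebra_simps)
  have A: "A > 0" unfolding A_def by (rule irwin_hall_pos) (use \<sigma> in auto)
  have B: "B \<ge> 0" and E: "E \<ge> 0" using irwin_hall_nonneg by (simp_all add: B_def E_def)
  have BA: "B < A"
  proof -
    have "3 * \<sigma> * B \<le> (real m + 3 - \<sigma>) * B" using \<sigma> B by (intro mult_right_mono) auto
    also have "\<dots> \<le> \<sigma> * A" using irwin_hall_ratio[of "m + 3" \<sigma>] \<sigma> by (simp add: A_def B_def)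
    finally have "\<sigma> * (3 * B) \<le> \<sigma> * A" by (simp add: mult_ac)
    then have "3 * B \<le> A" using \<sigma> by simp
    then show ?thesis using A B by linarith
  qed
  \<comment> \<open>for \<open>y = \<sigma> - 1 \<ge> 0\<close>, the recursion and the ratio bound give \<open>(m + 2) B \<le> 3 y E\<close>\<close>
  have BE: "(real m + 5) * B \<le> (real m + 3) * E"
  proof (cases "\<sigma> < 1")
    case True
    then show ?thesis using E by (simp add: B_def irwin_hall_neg)
  next
    case False
    define y where "y = \<sigma> - 1"
    define E' where "E' = irwin_hall (m + 2) (y - 1)"
    have y: "0 \<le> y" "y \<le> (real m - 1) / 4" using False \<sigma> by (auto simp: y_def)
    have E': "0 \<le> E'" using irwin_hall_nonneg by (simp add: E'_def)
    have "(real m + 2) * B = y * E + (real m + 3 - y) * E'"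
      using irwin_hall_rec[of "m + 2" y] by (simp add: E'_def E_def B_def y_def eval_nat_numeral algebra_simps)
    also have "\<dots> \<le> y * E + 2 * ((real m + 2 - y) * E')"
    proof -
      have "(real m + 3 - y) * E' \<le> 2 * (real m + 2 - y) * E'"
        using y E' by (intro mult_right_mono) auto
      then show ?thesis by (simp only: mult.assoc add_left_mono)
    qed
    also have "(real m + 2 - y) * E' \<le> y * E"
      using irwin_hall_ratio[of "m + 2" y] y by (simp add: E'_def E_def y_def)
    finally have "(real m + 2) * B \<le> 3 * y * E" by (simp add: mult_ac)
    then have "(real m + 5) * ((real m + 2) * B) \<le> (real m + 5) * (3 * y) * E"
      by (simp add: mult.assoc mult_left_mono)
    also have "\<dots> \<le> ((real m + 2) * (real m + 3)) * E"
    proof (rule mult_right_mono[OF _ E])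
      have "(real m + 5) * (3 * y) \<le> (real m + 5) * (3 * ((real m - 1) / 4))"
        using y by (intro mult_left_mono) auto
      also have "\<dots> \<le> (real m + 2) * (real m + 3)"
      proof -
        have "0 \<le> real m * real m" by simp
        then show ?thesis by (simp add: field_simps)
      qed
      finally show "(real m + 5) * (3 * y) \<le> (real m + 2) * (real m + 3)" .
    qed
    finally have "(real m + 2) * ((real m + 5) * B) \<le> (real m + 2) * ((real m + 3) * E)"
      by (simp add: mult_ac)
    then show ?thesis by (simp add: mult_le_cancel_left_pos)
  qed
  have "(real m + 3) * (A + B + 2 * E - 4 * p)
      = (real m + 3 - 4 * \<sigma>) * (A - B) + 2 * ((real m + 3) * E - (real m + 5) * B)"
    using rec by (simp add: algebra_simps)
  moreover have "0 < (real m + 3 - 4 * \<sigma>) * (A - B) + 2 * ((real m + 3) * E - (real m + 5) * B)"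
    using \<sigma> BA BE by (intro add_pos_nonneg) auto
  ultimately have "0 < (real m + 3) * (A + B + 2 * E - 4 * p)" by (simp only:)
  then have "0 < A + B + 2 * E - 4 * p" by (simp add: zero_less_mult_iff)
  then show ?thesis by (simp add: p_def A_def B_def E_def)
qed

section \<open>Second-order expansion at the diagonal\<close>

text \<open>The derivative of the remainder is \<open>o(\<delta>)\<close> because \<open>g\<close> is differentiable at \<open>u\<close>, and the mean
value theorem gains another factor \<open>\<delta>\<close>.  Unlike an estimate by third derivatives, this applies to
the cubic truncated power, which occurs for \<open>d = 4\<close>.\<close>
lemma second_order_taylor:
  fixes f g :: "real \<Rightarrow> real"
  assumes f: "\<forall>\<^sub>F x in nhds u. (f has_real_derivative g x) (at x)"
    and g: "(g has_real_derivative c) (at u)"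
  shows "(\<lambda>\<delta>. f (u + \<delta>) - f u - \<delta> * g u - \<delta>\<^sup>2 / 2 * c) \<in> o[nhds 0](\<lambda>\<delta>. \<delta>\<^sup>2)"
proof (rule landau_o.smallI)
  fix e :: real assume e: "e > 0"
  define \<phi> where "\<phi> = (\<lambda>\<delta>. f (u + \<delta>) - f u - \<delta> * g u - \<delta>\<^sup>2 / 2 * c)"
  obtain r1 where r1: "r1 > 0" "\<And>x. \<bar>x - u\<bar> < r1 \<Longrightarrow> (f has_real_derivative g x) (at x)"
    using f by (auto simp: eventually_nhds_metric dist_real_def)
  have "((\<lambda>h. (g (u + h) - g u) / h) \<longlongrightarrow> c) (at 0)" using g by (simp add: DERIV_def)
  then have "\<forall>\<^sub>F h in at 0. dist ((g (u + h) - g u) / h) c < e" using e by (rule tendstoD)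
  then obtain r2 where r2: "r2 > 0" "\<And>h. h \<noteq> 0 \<Longrightarrow> \<bar>h\<bar> < r2 \<Longrightarrow> \<bar>(g (u + h) - g u) / h - c\<bar> < e"
    by (auto simp: eventually_at dist_real_def)
  have g_bound: "\<bar>g (u + h) - g u - h * c\<bar> \<le> e * \<bar>h\<bar>" if "\<bar>h\<bar> < r2" for h :: real
  proof (cases "h = 0")
    case False
    have "\<bar>g (u + h) - g u - h * c\<bar> = \<bar>(g (u + h) - g u) / h - c\<bar> * \<bar>h\<bar>"
      using False by (simp add: abs_mult[symmetric] field_simps)
    also have "\<dots> \<le> e * \<bar>h\<bar>" using r2(2)[OF False that] by (intro mult_right_mono) auto
    finally show ?thesis .
  qed simp
  have "\<bar>\<phi> \<delta>\<bar> \<le> e * \<delta>\<^sup>2" if "\<bar>\<delta>\<bar> < min r1 r2" for \<delta> :: real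
  proof -
    have "\<bar>\<phi> \<delta> - \<phi> 0\<bar> \<le> (e * \<bar>\<delta>\<bar>) * \<bar>\<delta> - 0\<bar>"
    proof (rule field_differentiable_bound[where S="cball 0 \<bar>\<delta>\<bar>" and f'="\<lambda>h. g (u + h) - g u - h * c", unfolded real_norm_def])
      fix h :: real assume h: "h \<in> cball 0 \<bar>\<delta>\<bar>"
      have "(f has_real_derivative g (u + h)) (at (u + h))"
        using h that by (intro r1) auto
      then have f': "((\<lambda>h. f (u + h)) has_real_derivative g (u + h)) (at h)"
        using DERIV_shift[of f _ h u] by (simp add: add.commute)
      have lin': "((\<lambda>\<delta>. \<delta> * g u) has_real_derivative g u) (at h)"
        using DERIV_cmult_right[OF DERIV_ident, of "g u"] by simp
      have quad': "((\<lambda>\<delta>. \<delta>\<^sup>2 / 2 * c) has_real_derivative h * c) (at h)"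
        using DERIV_cmult_right[OF DERIV_cdivide[OF DERIV_pow[of 2 h UNIV], of 2], of c] by simp
      have "(\<phi> has_real_derivative g (u + h) - 0 - g u - h * c) (at h)"
        unfolding \<phi>_def by (rule DERIV_diff[OF DERIV_diff[OF DERIV_diff[OF f' DERIV_const] lin'] quad'])
      then show "(\<phi> has_real_derivative g (u + h) - g u - h * c) (at h within cball 0 \<bar>\<delta>\<bar>)"
        by (simp add: has_field_derivative_at_within)
      show "\<bar>g (u + h) - g u - h * c\<bar> \<le> e * \<bar>\<delta>\<bar>"
        using order_trans[OF g_bound mult_left_mono[of "\<bar>h\<bar>" "\<bar>\<delta>\<bar>" e]] h that e by auto
    qed auto
    moreover have "\<phi> 0 = 0" by (simp add: \<phi>_def)
    ultimately show ?thesis by (simp add: power2_eq_square mult.assoc)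
  qed
  then show "\<forall>\<^sub>F \<delta> in nhds 0. norm (f (u + \<delta>) - f u - \<delta> * g u - \<delta>\<^sup>2 / 2 * c) \<le> e * norm (\<delta>\<^sup>2)"
    unfolding eventually_nhds_metric \<phi>_def using r1(1) r2(1)
    by (intro exI[of _ "min r1 r2"]) (auto simp: dist_real_def)
qed

lemma tpow_taylor:
  "(\<lambda>\<delta>. tpow (m + 3) (u + \<delta>) - tpow (m + 3) u - \<delta> * tpow (m + 2) u - \<delta>\<^sup>2 / 2 * tpow (m + 1) u)
     \<in> o[nhds 0](\<lambda>\<delta>. \<delta>\<^sup>2)"
proof -
  have "(\<lambda>\<delta>. tpow (Suc (Suc (Suc m))) (u + \<delta>) - tpow (Suc (Suc (Suc m))) u - \<delta> * tpow (Suc (Suc m)) u - \<delta>\<^sup>2 / 2 * tpow (Suc m) u)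
     \<in> o[nhds 0](\<lambda>\<delta>. \<delta>\<^sup>2)"
    by (intro second_order_taylor always_eventually allI tpow_Suc_deriv) auto
  moreover have "m + 3 = Suc (Suc (Suc m))" "m + 2 = Suc (Suc m)" "m + 1 = Suc m" by simp_all
  ultimately show ?thesis by (simp only:)
qed

lemma ln_taylor: "(\<lambda>\<delta>. ln (1 + \<delta>) - \<delta> + \<delta>\<^sup>2 / 2) \<in> o[nhds 0](\<lambda>\<delta>::real. \<delta>\<^sup>2)"
proof -
  have "\<forall>\<^sub>F x in nhds (1::real). (ln has_real_derivative inverse x) (at x)"
    by (rule eventually_mono[OF eventually_nhds_in_open[of "{0<..}"]])
       (auto intro: DERIV_ln)
  moreover have "(inverse has_real_derivative -1) (at (1::real))"
    using DERIV_inverse[of "1::real" UNIV] by simp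
  ultimately show ?thesis using second_order_taylor[of ln inverse 1 "-1"] by simp
qed

text \<open>Exchanging the summations, \<open>h i\<close> is multiplied by the sum over the sets that contain \<open>i\<close>.  Removing
\<open>i\<close> from these sets leaves a difference of one order less, at \<open>x - 1\<close> and with a minus sign.\<close>
lemma sum_Pow_bdiff_linear:
  assumes "finite J"
  shows "(\<Sum>K\<in>Pow J. (-1) ^ card K * f (x - real (card K)) * (\<Sum>i\<in>K. h i))
    = - (\<Sum>i\<in>J. h i) * bdiff (card J - 1) f (x - 1)"
  using assms
proof (induction J arbitrary: x rule: finite_induct)
  case (insert j J)
  let ?L = "\<lambda>J x. \<Sum>K\<in>Pow J. (-1) ^ card K * f (x - real (card K)) * (\<Sum>i\<in>K. h i)"
  have step: "K \<subseteq> J \<Longrightarrow> card (insert j K) = Suc (card K)" "K \<subseteq> J \<Longrightarrow> (\<Sum>i\<in>insert j K. h i) = h j + (\<Sum>i\<in>K. h i)" for K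
    using insert.hyps finite_subset[of K J] by (auto intro: card_insert_disjoint sum.insert)
  have "?L (insert j J) x = ?L J x - ?L J (x - 1) - h j * (\<Sum>K\<in>Pow J. (-1) ^ card K * f (x - 1 - real (card K)))"
  proof -
    have "?L (insert j J) x = (\<Sum>K\<in>Pow J. (-1) ^ card K * f (x - real (card K)) * (\<Sum>i\<in>K. h i)
        - (-1) ^ card K * f (x - 1 - real (card K)) * (\<Sum>i\<in>K. h i)
        - h j * ((-1) ^ card K * f (x - 1 - real (card K))))"
      unfolding sum_Pow_insert[OF insert.hyps]
      by (intro sum.cong refl) (simp add: step algebra_simps)
    then show ?thesis by (simp only: sum_subtractf sum_distrib_left)
  qed
  also have "\<dots> = - (\<Sum>i\<in>J. h i) * (bdiff (card J - 1) f (x - 1) - bdiff (card J - 1) f (x - 2)) - h j * bdiff (card J) f (x - 1)"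
    unfolding insert.IH sum_Pow_bdiff[OF insert.hyps(1)] by (simp add: algebra_simps)
  also have "- (\<Sum>i\<in>J. h i) * (bdiff (card J - 1) f (x - 1) - bdiff (card J - 1) f (x - 2)) = - (\<Sum>i\<in>J. h i) * bdiff (card J) f (x - 1)"
    using insert.hyps by (cases "card J") (auto simp: algebra_simps)
  finally show ?case using insert.hyps by (simp add: algebra_simps)
qed simp

text \<open>As in the linear case, the coefficient of \<open>h i * h j\<close> is the sum over the sets that contain \<open>i\<close> and
\<open>j\<close>, which is a difference of order \<open>card J - 1\<close> for \<open>i = j\<close> and of order \<open>card J - 2\<close> otherwise.
The truncated subtraction for \<open>card J < 2\<close> does no harm, for then the first factor vanishes.\<close>
lemma sum_Pow_bdiff_quadratic:
  assumes "finite J"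
  shows "(\<Sum>K\<in>Pow J. (-1) ^ card K * f (x - real (card K)) * (\<Sum>i\<in>K. h i)\<^sup>2)
    = ((\<Sum>i\<in>J. h i)\<^sup>2 - (\<Sum>i\<in>J. (h i)\<^sup>2)) * bdiff (card J - 2) f (x - 2)
      - (\<Sum>i\<in>J. (h i)\<^sup>2) * bdiff (card J - 1) f (x - 1)"
  using assms
proof (induction J arbitrary: x rule: finite_induct)
  case (insert j J)
  let ?L = "\<lambda>J x. \<Sum>K\<in>Pow J. (-1) ^ card K * f (x - real (card K)) * (\<Sum>i\<in>K. h i)\<^sup>2"
  define S Q where "S = (\<Sum>i\<in>J. h i)" and "Q = (\<Sum>i\<in>J. (h i)\<^sup>2)"
  define n where "n = card J"
  have step: "K \<subseteq> J \<Longrightarrow> card (insert j K) = Suc (card K)" "K \<subseteq> J \<Longrightarrow> (\<Sum>i\<in>insert j K. h i) = h j + (\<Sum>i\<in>K. h i)" for K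
    using insert.hyps finite_subset[of K J] by (auto intro: card_insert_disjoint sum.insert)
  have "?L (insert j J) x = ?L J x - ?L J (x - 1)
      - 2 * h j * (\<Sum>K\<in>Pow J. (-1) ^ card K * f (x - 1 - real (card K)) * (\<Sum>i\<in>K. h i))
      - (h j)\<^sup>2 * (\<Sum>K\<in>Pow J. (-1) ^ card K * f (x - 1 - real (card K)))"
  proof -
    have "?L (insert j J) x = (\<Sum>K\<in>Pow J. (-1) ^ card K * f (x - real (card K)) * (\<Sum>i\<in>K. h i)\<^sup>2
        - (-1) ^ card K * f (x - 1 - real (card K)) * (\<Sum>i\<in>K. h i)\<^sup>2
        - 2 * h j * ((-1) ^ card K * f (x - 1 - real (card K)) * (\<Sum>i\<in>K. h i))
        - (h j)\<^sup>2 * ((-1) ^ card K * f (x - 1 - real (card K))))"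
      unfolding sum_Pow_insert[OF insert.hyps]
      by (intro sum.cong refl) (simp add: step algebra_simps power2_eq_square)
    then show ?thesis by (simp only: sum_subtractf sum_distrib_left)
  qed
  also have "\<dots> = (S\<^sup>2 - Q) * (bdiff (n - 2) f (x - 2) - bdiff (n - 2) f (x - 3))
      - Q * (bdiff (n - 1) f (x - 1) - bdiff (n - 1) f (x - 2))
      + 2 * h j * S * bdiff (n - 1) f (x - 2) - (h j)\<^sup>2 * bdiff n f (x - 1)"
    unfolding insert.IH sum_Pow_bdiff[OF insert.hyps(1)] sum_Pow_bdiff_linear[OF insert.hyps(1)]
      S_def[symmetric] Q_def[symmetric] n_def[symmetric]
    by (simp add: algebra_simps)
  also have "\<dots> = ((S + h j)\<^sup>2 - (Q + (h j)\<^sup>2)) * bdiff (n - 1) f (x - 2) - (Q + (h j)\<^sup>2) * bdiff n f (x - 1)"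
  proof -
    consider "n = 0" | "n = 1" | k where "n = Suc (Suc k)" by (metis One_nat_def not0_implies_Suc)
    then show ?thesis
    proof cases
      case 1
      then have "J = {}" using insert.hyps by (simp add: n_def)
      then show ?thesis using 1 by (simp add: S_def Q_def)
    next
      case 2
      then obtain i where "J = {i}" by (auto simp: n_def card_1_singleton_iff)
      then have "S\<^sup>2 = Q" by (simp add: S_def Q_def)
      then show ?thesis using 2 by (simp add: power2_eq_square algebra_simps)
    next
      case 3
      then show ?thesis by (simp add: power2_eq_square algebra_simps)
    qed
  qed
  finally show ?case using insert.hyps by (simp add: S_def Q_def n_def add.commute)
qed simp

text \<open>The hypothesis \<open>on_sphere\<close> says that \<open>\<Sum>\<^sub>i (1 + h\<^sub>i)\<^sup>2 = d\<close>.  It makes the linear terms of the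
expansion as small as the quadratic ones.  The numerator is then
\<open>p - q (A + B + 2 E) / 4 + o(q)\<close> and the product is at least \<open>1 - q + o(q)\<close>, where \<open>q = \<Sum>\<^sub>i h\<^sub>i\<^sup>2\<close>.
A filter is used so that \<open>h\<close> can later be a function of the normal vector of the hyperplane.\<close>
lemma perturbed_section_less:
  fixes h :: "'b \<Rightarrow> 'i \<Rightarrow> real" and F :: "'b filter" and J :: "'i set" and \<sigma> :: real
  assumes J: "finite J" "card J = m + 4"
    and lim: "\<And>i. i \<in> J \<Longrightarrow> ((\<lambda>x. h x i) \<longlongrightarrow> 0) F"
    and on_sphere: "\<forall>\<^sub>F x in F. (\<Sum>i\<in>J. h x i) = - (\<Sum>i\<in>J. (h x i)\<^sup>2) / 2"
    and nontrivial: "\<forall>\<^sub>F x in F. 0 < (\<Sum>i\<in>J. (h x i)\<^sup>2)"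
    and curvature: "4 * irwin_hall (m + 4) \<sigma>
       < irwin_hall (m + 3) \<sigma> + irwin_hall (m + 3) (\<sigma> - 1) + 2 * irwin_hall (m + 2) (\<sigma> - 1)"
  shows "\<forall>\<^sub>F x in F. (\<Sum>K\<in>Pow J. (-1) ^ card K *
             tpow (m + 3) (\<sigma> - real (card K) + ((\<Sum>i\<in>J. h x i) / 2 - (\<Sum>i\<in>K. h x i))))
           < irwin_hall (m + 4) \<sigma> * (\<Prod>i\<in>J. 1 + h x i)"
proof -
  define q where "q x = (\<Sum>i\<in>J. (h x i)\<^sup>2)" for x
  define \<delta> where "\<delta> K x = (\<Sum>i\<in>J. h x i) / 2 - (\<Sum>i\<in>K. h x i)" for K x
  define p A B E where "p = irwin_hall (m + 4) \<sigma>" and "A = irwin_hall (m + 3) \<sigma>"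
    and "B = irwin_hall (m + 3) (\<sigma> - 1)" and "E = irwin_hall (m + 2) (\<sigma> - 1)"
  define R where "R K x = tpow (m + 3) (\<sigma> - real (card K) + \<delta> K x) - tpow (m + 3) (\<sigma> - real (card K))
      - \<delta> K x * tpow (m + 2) (\<sigma> - real (card K)) - (\<delta> K x)\<^sup>2 / 2 * tpow (m + 1) (\<sigma> - real (card K))" for K x
  define R' where "R' i x = ln (1 + h x i) - h x i + (h x i)\<^sup>2 / 2" for i x
  \<comment> \<open>the coefficient of \<open>q\<^sup>2\<close>, collecting the terms with \<open>(\<Sum>\<^sub>i h\<^sub>i)\<^sup>2 = q\<^sup>2 / 4\<close>\<close>
  define C where "C = (bdiff (m + 4) (tpow (m + 1)) \<sigma> / 4 + bdiff (m + 3) (tpow (m + 1)) (\<sigma> - 1)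
      + bdiff (m + 2) (tpow (m + 1)) (\<sigma> - 2)) / 8"
  have q_nonneg: "0 \<le> q x" for x by (simp add: q_def sum_nonneg)
  have q_lim: "(q \<longlongrightarrow> 0) F"
  proof -
    have "((\<lambda>x. \<Sum>i\<in>J. (h x i)\<^sup>2) \<longlongrightarrow> (\<Sum>i\<in>J. 0\<^sup>2)) F" by (intro tendsto_intros lim)
    then show ?thesis by (simp add: q_def[abs_def])
  qed
  have R_small: "R K \<in> o[F](q)" if K: "K \<subseteq> J" for K
  proof -
    have "((\<lambda>x. (\<Sum>i\<in>J. h x i) / 2 - (\<Sum>i\<in>K. h x i)) \<longlongrightarrow> (\<Sum>i\<in>J. 0) / 2 - (\<Sum>i\<in>K. 0)) F"
      using K by (intro tendsto_intros lim) auto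
    then have "filterlim (\<delta> K) (nhds 0) F" by (simp add: \<delta>_def[abs_def])
    then have "(R K) \<in> o[F](\<lambda>x. (\<delta> K x)\<^sup>2)"
      unfolding R_def[abs_def] by (rule landau_o.small.compose[OF tpow_taylor])
    also have "(\<lambda>x. (\<delta> K x)\<^sup>2) \<in> O[F](q)"
    proof (rule landau_o.bigI[where c="real (card J) + 1"])
      have "(\<delta> K x)\<^sup>2 \<le> (real (card J) + 1) * q x" for x
      proof -
        have "(\<Sum>i\<in>J. (if i \<in> K then -1/2 else 1/2) * h x i)
            = (\<Sum>i\<in>J. h x i / 2 - (if i \<in> K then h x i else 0))"
          by (intro sum.cong) auto
        also have "\<dots> = \<delta> K x"
          using K J(1) by (simp add: sum_subtractf sum_divide_distrib sum.inter_restrict[symmetric] \<delta>_def Int_absorb1)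
        finally have "(\<delta> K x)\<^sup>2 \<le> (\<Sum>i\<in>J. (if i \<in> K then -1/2 else 1/2)\<^sup>2) * q x"
          unfolding q_def using Cauchy_Schwarz_ineq_sum[of "\<lambda>i. if i \<in> K then -1/2 else 1/2" "h x" J] by simp
        also have "(\<Sum>i\<in>J. (if i \<in> K then -1/2 else 1/2)\<^sup>2) \<le> (\<Sum>i\<in>J. 1::real)"
          by (intro sum_mono) (auto simp: power2_eq_square)
        then have "(\<Sum>i\<in>J. (if i \<in> K then -1/2 else 1/2)\<^sup>2) * q x \<le> (real (card J) + 1) * q x"
          using q_nonneg by (intro mult_right_mono) auto
        finally show ?thesis .
      qed
      then show "\<forall>\<^sub>F x in F. norm ((\<delta> K x)\<^sup>2) \<le> (real (card J) + 1) * norm (q x)"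
        using q_nonneg by simp
    qed simp
    finally show ?thesis .
  qed
  have R'_small: "R' i \<in> o[F](q)" if i: "i \<in> J" for i
  proof -
    have "(R' i) \<in> o[F](\<lambda>x. (h x i)\<^sup>2)"
      unfolding R'_def[abs_def] by (rule landau_o.small.compose[OF ln_taylor lim[OF i]])
    also have "(\<lambda>x. (h x i)\<^sup>2) \<in> O[F](q)"
    proof (rule landau_o.bigI[where c=1])
      show "\<forall>\<^sub>F x in F. norm ((h x i)\<^sup>2) \<le> 1 * norm (q x)"
        using member_le_sum[of i J "\<lambda>i. (h _ i)\<^sup>2"] i J(1) q_nonneg by (simp add: q_def)
    qed simp
    finally show ?thesis .
  qed
  define \<rho> where "\<rho> x = p * (\<Sum>i\<in>J. R' i x) - C * (q x * q x) - (\<Sum>K\<in>Pow J. (-1) ^ card K * R K x)" for x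
  have \<rho>_small: "\<rho> \<in> o[F](q)"
  proof -
    have "(\<lambda>x. q x) \<in> o[F](\<lambda>_. 1)" using q_lim by (intro smalloI_tendsto) auto
    then have "(\<lambda>x. q x * q x) \<in> o[F](\<lambda>x. q x * 1)" by (intro landau_o.big_small_mult) auto
    moreover have "(\<lambda>x. \<Sum>i\<in>J. R' i x) \<in> o[F](q)" by (intro big_sum_in_smallo R'_small)
    moreover have "(\<lambda>x. \<Sum>K\<in>Pow J. (-1) ^ card K * R K x) \<in> o[F](q)"
      by (intro big_sum_in_smallo) (auto intro!: R_small)
    ultimately show ?thesis unfolding \<rho>_def[abs_def]
      by (intro sum_in_smallo) auto
  qed
  define \<kappa> where "\<kappa> = A + B + 2 * E - 4 * p"
  have \<kappa>: "\<kappa> > 0" using curvature by (simp add: \<kappa>_def p_def A_def B_def E_def)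
  have p: "p \<ge> 0" using irwin_hall_nonneg[of "m + 4" \<sigma>] by (simp add: p_def)
  have expansion: "(\<Sum>K\<in>Pow J. (-1) ^ card K * tpow (m + 3) (\<sigma> - real (card K) + \<delta> K x))
      = p - q x * (A + B + 2 * E) / 4 + C * (q x * q x) + (\<Sum>K\<in>Pow J. (-1) ^ card K * R K x)"
    if S: "(\<Sum>i\<in>J. h x i) = - q x / 2" for x
  proof -
    let ?u = "\<lambda>K. \<sigma> - real (card K)"
    let ?s = "\<lambda>K. \<Sum>i\<in>K. h x i"
    have "(\<Sum>K\<in>Pow J. (-1) ^ card K * tpow (m + 3) (?u K + \<delta> K x))
      = (\<Sum>K\<in>Pow J. (-1) ^ card K * tpow (m + 3) (?u K))
      + ?s J / 2 * (\<Sum>K\<in>Pow J. (-1) ^ card K * tpow (m + 2) (?u K))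
      - (\<Sum>K\<in>Pow J. (-1) ^ card K * tpow (m + 2) (?u K) * ?s K)
      + (?s J)\<^sup>2 / 8 * (\<Sum>K\<in>Pow J. (-1) ^ card K * tpow (m + 1) (?u K))
      - ?s J / 2 * (\<Sum>K\<in>Pow J. (-1) ^ card K * tpow (m + 1) (?u K) * ?s K)
      + 1 / 2 * (\<Sum>K\<in>Pow J. (-1) ^ card K * tpow (m + 1) (?u K) * (?s K)\<^sup>2)
      + (\<Sum>K\<in>Pow J. (-1) ^ card K * R K x)"
    proof -
      have "(\<Sum>K\<in>Pow J. (-1) ^ card K * tpow (m + 3) (?u K + \<delta> K x)) = (\<Sum>K\<in>Pow J.
          (-1) ^ card K * tpow (m + 3) (?u K)
          + ?s J / 2 * ((-1) ^ card K * tpow (m + 2) (?u K))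
          - (-1) ^ card K * tpow (m + 2) (?u K) * ?s K
          + (?s J)\<^sup>2 / 8 * ((-1) ^ card K * tpow (m + 1) (?u K))
          - ?s J / 2 * ((-1) ^ card K * tpow (m + 1) (?u K) * ?s K)
          + 1 / 2 * ((-1) ^ card K * tpow (m + 1) (?u K) * (?s K)\<^sup>2)
          + (-1) ^ card K * R K x)"
        by (intro sum.cong refl) (simp add: R_def \<delta>_def field_simps power2_eq_square)
      then show ?thesis by (simp only: sum.distrib sum_subtractf sum_distrib_left)
    qed
    also have "\<dots> = p + ?s J / 2 * (A - B) + ?s J * B + (?s J)\<^sup>2 / 8 * bdiff (m + 4) (tpow (m + 1)) \<sigma>
      + (?s J)\<^sup>2 / 2 * bdiff (m + 3) (tpow (m + 1)) (\<sigma> - 1)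
      + 1 / 2 * (((?s J)\<^sup>2 - q x) * bdiff (m + 2) (tpow (m + 1)) (\<sigma> - 2) - q x * bdiff (m + 3) (tpow (m + 1)) (\<sigma> - 1))
      + (\<Sum>K\<in>Pow J. (-1) ^ card K * R K x)"
    proof -
      have "m + 4 = Suc (m + 3)" by simp
      then have AB: "bdiff (m + 4) (tpow (m + 2)) \<sigma> = A - B"
        by (simp only: bdiff.simps) (simp add: A_def B_def irwin_hall_def)
      have idx: "m + 4 - 1 = m + 3" "m + 4 - 2 = m + 2" "m + 3 - 1 = m + 2" by simp_all
      have pB: "p = bdiff (m + 4) (tpow (m + 3)) \<sigma>" "bdiff (m + 3) (tpow (m + 2)) (\<sigma> - 1) = B"
        by (simp_all only: p_def B_def irwin_hall_def idx)
      show ?thesis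
        unfolding sum_Pow_bdiff[OF J(1)] sum_Pow_bdiff_linear[OF J(1)] sum_Pow_bdiff_quadratic[OF J(1)]
          J(2) idx q_def[symmetric] AB pB
        by (simp add: power2_eq_square algebra_simps)
    qed
    also have "bdiff (m + 3) (tpow (m + 1)) (\<sigma> - 1) = E - bdiff (m + 2) (tpow (m + 1)) (\<sigma> - 2)"
    proof -
      have "m + 3 = Suc (m + 2)" by simp
      then show ?thesis by (simp only: bdiff.simps) (simp add: E_def irwin_hall_def)
    qed
    also have "p + ?s J / 2 * (A - B) + ?s J * B + (?s J)\<^sup>2 / 8 * bdiff (m + 4) (tpow (m + 1)) \<sigma>
      + (?s J)\<^sup>2 / 2 * (E - bdiff (m + 2) (tpow (m + 1)) (\<sigma> - 2))
      + 1 / 2 * (((?s J)\<^sup>2 - q x) * bdiff (m + 2) (tpow (m + 1)) (\<sigma> - 2) - q x * (E - bdiff (m + 2) (tpow (m + 1)) (\<sigma> - 2)))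
      = p - q x * (A + B + 2 * E) / 4 + C * (q x * q x)"
    proof -
      have "m + 3 = Suc (m + 2)" by simp
      then have "bdiff (m + 3) (tpow (m + 1)) (\<sigma> - 1) = E - bdiff (m + 2) (tpow (m + 1)) (\<sigma> - 2)"
        by (simp only: bdiff.simps) (simp add: E_def irwin_hall_def)
      note step = this
      show ?thesis unfolding C_def S step by (simp add: field_simps power2_eq_square del: bdiff.simps)
    qed
    finally show ?thesis .
  qed
  have "\<forall>\<^sub>F x in F. \<forall>i\<in>J. h x i > -1"
    using J(1) by (intro eventually_ball_finite ballI order_tendstoD(1)[OF lim]) auto
  moreover have "\<forall>\<^sub>F x in F. norm (\<rho> x) \<le> \<kappa> / 8 * norm (q x)"
    using \<kappa> by (intro landau_o.smallD[OF \<rho>_small]) simp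
  ultimately show ?thesis using on_sphere nontrivial
  proof eventually_elim
    case (elim x)
    have S: "(\<Sum>i\<in>J. h x i) = - q x / 2" and q: "0 < q x" using elim by (simp_all add: q_def)
    have pos: "1 + h x i > 0" if "i \<in> J" for i using elim that by force
    \<comment> \<open>taking logarithms replaces the expansion of the product by one for each factor\<close>
    have "1 + (\<Sum>i\<in>J. ln (1 + h x i)) \<le> exp (\<Sum>i\<in>J. ln (1 + h x i))" by (rule exp_ge_add_one_self)
    also have "\<dots> = (\<Prod>i\<in>J. 1 + h x i)" using J(1) pos by (simp add: exp_sum)
    finally have "1 + (\<Sum>i\<in>J. ln (1 + h x i)) \<le> (\<Prod>i\<in>J. 1 + h x i)" .
    moreover have "(\<Sum>i\<in>J. ln (1 + h x i)) = (\<Sum>i\<in>J. h x i) - q x / 2 + (\<Sum>i\<in>J. R' i x)"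
      by (simp add: R'_def q_def sum.distrib sum_subtractf sum_divide_distrib)
    ultimately have "1 - q x + (\<Sum>i\<in>J. R' i x) \<le> (\<Prod>i\<in>J. 1 + h x i)" using S by simp
    then have "p * (1 - q x + (\<Sum>i\<in>J. R' i x)) \<le> p * (\<Prod>i\<in>J. 1 + h x i)"
      using p by (rule mult_left_mono)
    moreover have "p * (1 - q x + (\<Sum>i\<in>J. R' i x))
        - (p - q x * (A + B + 2 * E) / 4 + C * (q x * q x) + (\<Sum>K\<in>Pow J. (-1) ^ card K * R K x))
      = q x * \<kappa> / 4 + \<rho> x"
      by (simp add: \<kappa>_def \<rho>_def field_simps)
    moreover have "- (\<kappa> / 8 * q x) \<le> \<rho> x" using elim q by (simp add: abs_le_iff)
    moreover have "0 < \<kappa> * q x" using \<kappa> q by simp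
    ultimately show ?case
      unfolding \<delta>_def[symmetric] expansion[OF S] p_def[symmetric] by (simp add: algebra_simps)
  qed
qed

section \<open>Sections of the unit cube\<close>

lemma inner_one_Basis: "c \<in> Basis \<Longrightarrow> (1 :: real ^ 'n) \<bullet> c = 1"
  by (auto simp: Basis_vec_def inner_axis)

lemma sum_components_eq: "(\<Sum>i\<in>UNIV. (a :: real ^ 'n) $ i) = (\<Sum>c\<in>Basis. a \<bullet> c)"
proof -
  have "(\<Sum>c\<in>Basis. a \<bullet> c) = 1 \<bullet> a"
    by (subst euclidean_inner[of 1 a]) (simp add: inner_one_Basis)
  then show ?thesis by (simp add: inner_vec_def)
qed

lemma unit_cube_iff: "x \<in> unit_cube \<longleftrightarrow> (\<forall>c\<in>Basis. x \<bullet> c \<in> {0..1})"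
  by (auto simp: unit_cube_def mem_box inner_one_Basis)

lemma measure_unit_cube_halfspace:
  fixes a :: "real ^ 'n"
  assumes "\<And>c. c \<in> Basis \<Longrightarrow> a \<bullet> c \<noteq> 0"
  shows "measure lborel {x\<in>unit_cube. a \<bullet> x \<le> r}
    = halfspace_num Basis ((\<bullet>) a) CARD('n) (r - (\<Sum>c\<in>Basis. a \<bullet> c) / 2) / (\<Prod>c\<in>Basis. \<bar>a \<bullet> c\<bar>)"
proof -
  let ?P = "\<Pi>\<^sub>M c\<in>(Basis :: (real ^ 'n) set). (lborel :: real measure)"
  let ?e = "\<lambda>f. \<Sum>c\<in>Basis. f c *\<^sub>R c :: real ^ 'n"
  let ?v = "r - (\<Sum>c\<in>Basis. a \<bullet> c) / 2"
  have [measurable]: "{x\<in>unit_cube. a \<bullet> x \<le> r} \<in> sets borel" unfolding unit_cube_def by measurable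
  have "emeasure lborel {x\<in>unit_cube. a \<bullet> x \<le> r} = emeasure (distr ?P borel ?e) {x\<in>unit_cube. a \<bullet> x \<le> r}"
    by (simp add: lborel_def[where 'a = "real ^ 'n"] lborel_eq_real)
  also have "\<dots> = emeasure ?P (?e -` {x\<in>unit_cube. a \<bullet> x \<le> r} \<inter> space ?P)"
    by (rule emeasure_distr) measurable
  also have "?e -` {x\<in>unit_cube. a \<bullet> x \<le> r} \<inter> space ?P
     = {f \<in> space ?P. (\<forall>c\<in>Basis. f c \<in> {0..1}) \<and> (\<Sum>c\<in>Basis. a \<bullet> c * (f c - 1/2)) \<le> ?v}"
  proof -
    have "a \<bullet> ?e f \<le> r \<longleftrightarrow> (\<Sum>c\<in>Basis. a \<bullet> c * (f c - 1/2)) \<le> ?v" for f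
    proof -
      have "a \<bullet> ?e f = (\<Sum>c\<in>Basis. a \<bullet> c * f c)" by (simp add: inner_sum_right mult.commute)
      moreover have "(\<Sum>c\<in>Basis. a \<bullet> c * (f c - 1/2)) = (\<Sum>c\<in>Basis. a \<bullet> c * f c) - (\<Sum>c\<in>Basis. a \<bullet> c) / 2"
        by (simp add: right_diff_distrib sum_subtractf sum_divide_distrib)
      ultimately show ?thesis by simp
    qed
    then show ?thesis by (auto simp: unit_cube_iff)
  qed
  finally show ?thesis
    using halfspace_PiM[of "Basis :: (real ^ 'n) set" "(\<bullet>) a" ?v] assms by (simp add: measure_def)
qed

text \<open>The frontier of the cube lies in the hyperplanes of its faces, none of which is parallel to the
section because every coordinate of \<open>a\<close> is nonzero and there are at least two of them.  The
choice of coordinates in the definition of the measure on the section is immaterial: for any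
choice the measure is the same derivative.\<close>
lemma section_volume_formula:
  fixes a :: "real ^ 'n"
  assumes unit: "norm a = 1" and nz: "\<And>c. c \<in> Basis \<Longrightarrow> a \<bullet> c \<noteq> 0" and card: "CARD('n) = Suc (Suc m)"
  shows "section_volume t a
    = halfspace_num Basis ((\<bullet>) a) (Suc m) (- t) / (\<Prod>c\<in>Basis. \<bar>a \<bullet> c\<bar>)"
proof -
  define s where "s = (\<Sum>c\<in>Basis. a \<bullet> c) / 2 - t"
  define H where "H = {x. a \<bullet> x = s}"
  have H: "section_hyperplane t a = H"
    by (simp add: section_hyperplane_def H_def s_def sum_components_eq)
  obtain p B where pB: "(SOME (p, B). affine_coords H p B) = (p, B)" by fastforce
  have "\<exists>pB. case pB of (p, B) \<Rightarrow> affine_coords H p B"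
    using affine_coords_hyperplane_exists[OF unit, of s] by (auto simp: H_def)
  then have "affine_coords H p B" using someI_ex[of "\<lambda>(p, B). affine_coords H p B"] pB by simp
  then interpret hyperplane_coords a p s B
    using unit by unfold_locales (simp_all add: H_def)
  define F where "F = (Basis :: (real ^ 'n) set) \<times> {0, 1::real}"
  have cube_compact: "compact (unit_cube :: (real ^ 'n) set)" by (simp add: unit_cube_def compact_cbox)
  have "measure coord_measure (chart 0 -` unit_cube \<inter> space coord_measure)
      = halfspace_num Basis ((\<bullet>) a) (Suc m) (s - (\<Sum>c\<in>Basis. a \<bullet> c) / 2) / (\<Prod>c\<in>Basis. \<bar>a \<bullet> c\<bar>)"
  proof (rule section_measure_eq_derivative[OF cube_compact])
    show "finite F" by (simp add: F_def)
    show "frontier unit_cube \<subseteq> (\<Union>(w, c)\<in>F. {x. w \<bullet> x = c})"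
    proof
      fix x :: "real ^ 'n" assume x: "x \<in> frontier unit_cube"
      then have "x \<in> unit_cube" "x \<notin> box 0 1"
        by (auto simp: unit_cube_def frontier_def closure_closed[OF closed_cbox] interior_cbox)
      then obtain c where "c \<in> Basis" "x \<bullet> c = 0 \<or> x \<bullet> c = 1"
        by (fastforce simp: unit_cube_iff mem_box inner_one_Basis)
      then have "(c, 0) \<in> F \<and> c \<bullet> x = 0 \<or> (c, 1) \<in> F \<and> c \<bullet> x = 1" by (auto simp: F_def inner_commute)
      then show "x \<in> (\<Union>(w, c)\<in>F. {x. w \<bullet> x = c})" by auto
    qed
    show "w \<noteq> r *\<^sub>R a" if "(w, c) \<in> F" for w c r
    proof
      assume w: "w = r *\<^sub>R a"
      have wB: "w \<in> Basis" using that by (simp add: F_def)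
      have "card (Basis - {w}) \<noteq> 0" using wB card by (simp add: card_Diff_singleton)
      then obtain c' where c': "c' \<in> Basis" "c' \<noteq> w" by (metis Diff_iff card.empty equals0I singletonI)
      then have "r * (a \<bullet> c') = 0" using w wB inner_Basis[OF wB c'(1)] by simp
      then have "w = 0" using w nz c' by simp
      then show False using wB by auto
    qed
    have "((\<lambda>r. halfspace_num Basis ((\<bullet>) a) (Suc (Suc m)) (r - (\<Sum>c\<in>Basis. a \<bullet> c) / 2))
        has_real_derivative halfspace_num Basis ((\<bullet>) a) (Suc m) (s - (\<Sum>c\<in>Basis. a \<bullet> c) / 2)) (at s)"
      using halfspace_num_deriv[of Basis "(\<bullet>) a" m] 
      by (subst diff_conv_add_uminus, subst DERIV_shift[symmetric]) simp
    moreover have "(\<lambda>r. measure lborel {x\<in>unit_cube. a \<bullet> x \<le> r})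
      = (\<lambda>r. halfspace_num Basis ((\<bullet>) a) (Suc (Suc m)) (r - (\<Sum>c\<in>Basis. a \<bullet> c) / 2) / (\<Prod>c\<in>Basis. \<bar>a \<bullet> c\<bar>))"
      using measure_unit_cube_halfspace[OF nz] card by (intro ext) simp
    ultimately show "((\<lambda>r. measure lborel {x\<in>unit_cube. a \<bullet> x \<le> r}) has_real_derivative
       halfspace_num Basis ((\<bullet>) a) (Suc m) (s - (\<Sum>c\<in>Basis. a \<bullet> c) / 2) / (\<Prod>c\<in>Basis. \<bar>a \<bullet> c\<bar>)) (at s)"
      by (simp only: DERIV_cdivide)
  qed
  moreover have "section_volume t a = measure coord_measure (chart 0 -` unit_cube \<inter> space coord_measure)"
  proof -
    have chart: "(\<lambda>y. p + (\<Sum>b\<in>B. y b *\<^sub>R b)) = chart 0" by (simp add: chart_def fun_eq_iff)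
    have "section_volume t a = measure (distr coord_measure borel (chart 0)) (H \<inter> unit_cube)"
      by (simp add: section_volume_def H affine_lborel_def pB chart)
    also have "\<dots> = measure coord_measure (chart 0 -` (H \<inter> unit_cube) \<inter> space coord_measure)"
      by (rule measure_distr) (auto simp: H_def unit_cube_def intro!: borel_closed closed_Int closed_hyperplane)
    also have "chart 0 -` (H \<inter> unit_cube) = chart 0 -` unit_cube" by (auto simp: H_def inner_chart)
    finally show ?thesis .
  qed
  ultimately show ?thesis by (simp add: s_def)
qed

lemma tpow_scale: "\<mu> > 0 \<Longrightarrow> tpow m (\<mu> * x) = \<mu> ^ m * tpow m x"
  by (simp add: tpow_def mult_less_0_iff power_mult_distrib)

text \<open>Homogeneity of the truncated powers turns the factor \<open>1 / \<surd>d\<close> of the coordinates into the factor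
\<open>\<surd>d\<close> of the volume, and the offset \<open>- t\<close> from the centre into \<open>\<sigma> = d/2 - t \<surd>d\<close>.\<close>
lemma section_volume_near_diagonal:
  fixes a :: "real ^ 'n" and h :: "real ^ 'n \<Rightarrow> real"
  assumes unit: "norm a = 1" and card: "CARD('n) = m + 4"
    and h: "\<And>c. c \<in> Basis \<Longrightarrow> \<bar>a \<bullet> c\<bar> = (1 + h c) / sqrt (m + 4)"
    and pos: "\<And>c. c \<in> Basis \<Longrightarrow> 0 < 1 + h c"
  shows "section_volume t a = sqrt (m + 4) * (\<Sum>K\<in>Pow Basis. (-1) ^ card K *
      tpow (m + 3) ((m + 4) / 2 - t * sqrt (m + 4) - real (card K) + ((\<Sum>c\<in>Basis. h c) / 2 - (\<Sum>c\<in>K. h c))))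
      / (\<Prod>c\<in>Basis. 1 + h c)"
proof -
  define \<mu> where "\<mu> = 1 / sqrt (m + 4)"
  have \<mu>: "\<mu> > 0" by (simp add: \<mu>_def)
  let ?M = "\<lambda>K. (m + 4) / 2 - t * sqrt (m + 4) - real (card K) + ((\<Sum>c\<in>Basis. h c) / 2 - (\<Sum>c\<in>K. h c))"
  have abs: "\<bar>a \<bullet> c\<bar> = \<mu> * (1 + h c)" if "c \<in> Basis" for c using h[OF that] by (simp add: \<mu>_def)
  have "halfspace_num Basis ((\<bullet>) a) (m + 3) (- t) = (\<Sum>K\<in>Pow Basis. (-1) ^ card K * (\<mu> ^ (m + 3) * tpow (m + 3) (?M K)))"
    unfolding halfspace_num_def
  proof (intro sum.cong refl arg_cong2[where f="(*)"])
    fix K :: "(real ^ 'n) set" assume "K \<in> Pow Basis"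
    then have K: "K \<subseteq> Basis" by simp
    have S: "(\<Sum>c\<in>K. \<bar>a \<bullet> c\<bar>) = \<mu> * (real (card K) + (\<Sum>c\<in>K. h c))" if "K \<subseteq> Basis" for K
    proof -
      have "(\<Sum>c\<in>K. \<bar>a \<bullet> c\<bar>) = (\<Sum>c\<in>K. \<mu> * (1 + h c))" using that by (intro sum.cong abs) auto
      then show ?thesis by (simp add: sum_distrib_left[symmetric] sum.distrib)
    qed
    have t: "t = \<mu> * (t * sqrt (m + 4))" by (simp add: \<mu>_def)
    have "- t + (\<Sum>c\<in>Basis. \<bar>a \<bullet> c\<bar>) / 2 - (\<Sum>c\<in>K. \<bar>a \<bullet> c\<bar>) = \<mu> * ?M K"
      unfolding S[OF K] S[OF order_refl] by (subst t) (simp add: card algebra_simps add_divide_distrib)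
    then show "tpow (m + 3) (- t + (\<Sum>c\<in>Basis. \<bar>a \<bullet> c\<bar>) / 2 - (\<Sum>c\<in>K. \<bar>a \<bullet> c\<bar>)) = \<mu> ^ (m + 3) * tpow (m + 3) (?M K)"
      using tpow_scale[OF \<mu>] by simp
  qed
  also have "\<dots> = \<mu> ^ (m + 3) * (\<Sum>K\<in>Pow Basis. (-1) ^ card K * tpow (m + 3) (?M K))"
    by (simp add: sum_distrib_left mult.left_commute)
  finally have num: "halfspace_num Basis ((\<bullet>) a) (m + 3) (- t) = \<mu> ^ (m + 3) * (\<Sum>K\<in>Pow Basis. (-1) ^ card K * tpow (m + 3) (?M K))" .
  have "(\<Prod>c\<in>Basis. \<bar>a \<bullet> c\<bar>) = (\<Prod>c\<in>Basis. \<mu> * (1 + h c))" by (intro prod.cong refl abs)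
  also have "\<dots> = \<mu> ^ (m + 4) * (\<Prod>c\<in>Basis. 1 + h c)" by (simp add: prod.distrib card)
  finally have den: "(\<Prod>c\<in>Basis. \<bar>a \<bullet> c\<bar>) = \<mu> ^ (m + 3) * (\<mu> * (\<Prod>c\<in>Basis. 1 + h c))"
    by (simp add: eval_nat_numeral)
  have "a \<bullet> c \<noteq> 0" if "c \<in> Basis" for c using abs[OF that] pos[OF that] \<mu> by auto
  then have "section_volume t a = halfspace_num Basis ((\<bullet>) a) (m + 3) (- t) / (\<Prod>c\<in>Basis. \<bar>a \<bullet> c\<bar>)"
    using section_volume_formula[OF unit, of "m + 2" t] card by (simp add: eval_nat_numeral)
  also have "\<dots> = (\<Sum>K\<in>Pow Basis. (-1) ^ card K * tpow (m + 3) (?M K)) / (\<mu> * (\<Prod>c\<in>Basis. 1 + h c))"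
    unfolding num den using \<mu> by simp
  finally show ?thesis by (simp add: \<mu>_def)
qed

lemma unit_vector_parallel_to_cube_diagonal:
  fixes a :: "real ^ 'n"
  assumes D: "cube_diagonal D" and par: "parallel_to_segment a D" and unit: "norm a = 1" and c: "c \<in> Basis"
  shows "\<bar>a \<bullet> c\<bar> = 1 / sqrt CARD('n)"
proof -
  obtain u :: "real ^ 'n" where u: "\<And>i. u $ i \<in> {0, 1}" "D = closed_segment u (1 - u)"
    using D by (auto simp: cube_diagonal_def)
  obtain v w k where vw: "D = closed_segment v w" "a = k *\<^sub>R (w - v)"
    using par by (auto simp: parallel_to_segment_def)
  have "{v, w} = {u, 1 - u}" using u(2) vw(1) by (simp add: closed_segment_eq)
  then have wv: "w - v = 1 - 2 *\<^sub>R u \<or> w - v = - (1 - 2 *\<^sub>R u)"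
    by (auto simp: doubleton_eq_iff scaleR_2)
  have "\<bar>(w - v) \<bullet> c\<bar> = 1" if c: "c \<in> Basis" for c
  proof -
    obtain i where "c = axis i 1" using c by (auto simp: Basis_vec_def)
    then have "u \<bullet> c = u $ i" by (simp add: inner_axis)
    then have "\<bar>(1 - 2 *\<^sub>R u) \<bullet> c\<bar> = 1"
      using u(1)[of i] c by (auto simp: inner_diff_left inner_one_Basis)
    then show ?thesis using wv by (elim disjE) (simp_all only: inner_minus_left abs_minus_cancel)
  qed
  then have abs: "\<bar>a \<bullet> c\<bar> = \<bar>k\<bar>" if "c \<in> Basis" for c
    using that by (simp add: vw(2) abs_mult)
  have "1 = a \<bullet> a" using unit by (simp add: norm_eq_1)
  also have "\<dots> = (\<Sum>c\<in>Basis. (a \<bullet> c)\<^sup>2)"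
    unfolding power2_eq_square by (rule euclidean_inner)
  also have "\<dots> = (\<Sum>c\<in>(Basis :: (real ^ 'n) set). k\<^sup>2)"
    by (intro sum.cong refl) (metis abs power2_abs)
  finally have "real CARD('n) * k\<^sup>2 = 1" by simp
  then have "sqrt CARD('n) * \<bar>k\<bar> = 1" by (metis real_sqrt_abs real_sqrt_mult real_sqrt_one)
  then show ?thesis using abs[OF c] by (simp add: field_simps)
qed

theorem theorem1p2:
  fixes d :: nat and t :: real
  assumes "CARD('n::finite) = d" and "d \<ge> 4"
    and "sqrt (real d) / 2
           - 1 / sqrt (real d)
             * min ((real d - 1) / 4)
                   (real d powr (1 / (real d - 3)) / (real d powr (1 / (real d - 3)) - 1)) < t"
    and "t < sqrt (real d) / 2"
  shows "\<forall>D :: (real ^ 'n) set. cube_diagonal D \<longrightarrow>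
           (\<forall>a \<in> sphere 0 1. parallel_to_segment a D \<longrightarrow>
              strict_local_max_on (sphere 0 1) (section_volume t) a)"
proof (intro allI impI ballI)
  fix D :: "(real ^ 'n) set" and a :: "real ^ 'n"
  assume D: "cube_diagonal D" and a: "a \<in> sphere 0 1" and par: "parallel_to_segment a D"
  obtain m where d: "d = m + 4" using \<open>d \<ge> 4\<close> by (metis le_add_diff_inverse2)
  have card: "CARD('n) = m + 4" using assms(1) d by simp
  define r where "r = sqrt (real m + 4)"
  have r: "r > 0" "r * r = real m + 4" by (simp_all add: r_def)
  define \<sigma> where "\<sigma> = (real m + 4) / 2 - t * r"
  have \<sigma>: "0 < \<sigma>" "\<sigma> < (real m + 3) / 4"
  proof -
    have "t * r < r / 2 * r" using assms(4) r by (intro mult_strict_right_mono) (auto simp: d r_def)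
    then show "0 < \<sigma>" using r by (simp add: \<sigma>_def)
    have "r / 2 - 1 / r * ((real m + 3) / 4)
        \<le> r / 2 - 1 / r * min ((real m + 3) / 4) ((real m + 4) powr (1 / (real m + 1)) / ((real m + 4) powr (1 / (real m + 1)) - 1))"
      using r by (intro diff_left_mono mult_left_mono min.cobounded1) auto
    also have "\<dots> < t" using assms(3) by (simp add: d r_def add.commute)
    finally have "(r / 2 - 1 / r * ((real m + 3) / 4)) * r < t * r"
      using r(1) by (rule mult_strict_right_mono)
    moreover have "(r / 2 - 1 / r * ((real m + 3) / 4)) * r = r * r / 2 - (real m + 3) / 4"
      using r(1) by (simp add: field_simps)
    ultimately have "(real m + 4) / 2 - (real m + 3) / 4 < t * r" by (simp only: r(2))
    then show "\<sigma> < (real m + 3) / 4" unfolding \<sigma>_def by linarith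
  qed
  have unit: "norm a = 1" using a by simp
  have a_abs: "\<bar>a \<bullet> c\<bar> = 1 / r" if "c \<in> Basis" for c
    using unit_vector_parallel_to_cube_diagonal[OF D par unit that] card by (simp add: r_def)
  define h where "h x c = r * \<bar>x \<bullet> c\<bar> - 1" for x c :: "real ^ 'n"
  define M where "M k = (\<Sum>K\<in>Pow Basis. (-1) ^ card K *
      tpow (m + 3) (\<sigma> - real (card K) + ((\<Sum>c\<in>Basis. k c) / 2 - (\<Sum>c\<in>K. k c))))" for k :: "real ^ 'n \<Rightarrow> real"
  have vol: "section_volume t x = r * M (h x) / (\<Prod>c\<in>Basis. 1 + h x c)"
    if "norm x = 1" "\<And>c. c \<in> Basis \<Longrightarrow> x \<bullet> c \<noteq> 0" for x
    using section_volume_near_diagonal[OF that(1) card, of "h x" t] that r(1)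
    by (simp add: h_def M_def \<sigma>_def r_def)
  have h_a: "h a c = 0" if "c \<in> Basis" for c using a_abs[OF that] r by (simp add: h_def)
  have vol_a: "section_volume t a = r * irwin_hall (m + 4) \<sigma>"
  proof -
    have "(\<Sum>c\<in>K. h a c) = 0" if "K \<subseteq> Basis" for K using that h_a by (intro sum.neutral) auto
    then have "M (h a) = (\<Sum>K\<in>Pow (Basis :: (real ^ 'n) set). (-1) ^ card K * tpow (m + 3) (\<sigma> - real (card K)))"
      unfolding M_def by (intro sum.cong refl) simp
    also have "\<dots> = irwin_hall (m + 4) \<sigma>" by (simp add: sum_Pow_bdiff card irwin_hall_def add.commute)
    finally have "M (h a) = irwin_hall (m + 4) \<sigma>" .
    moreover have "(\<Prod>c\<in>Basis. 1 + h a c) = 1" by (intro prod.neutral) (simp add: h_a)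
    moreover have "a \<bullet> c \<noteq> 0" if "c \<in> Basis" for c using a_abs[OF that] r by auto
    ultimately show ?thesis using vol[OF unit] by simp
  qed
  let ?F = "at a within sphere 0 1"
  have on_sphere: "\<forall>\<^sub>F x in ?F. x \<in> sphere 0 1 \<and> x \<noteq> a"
    by (auto simp: eventually_at_filter)
  \<comment> \<open>\<open>h\<close> determines the coordinates only up to sign, so near \<open>a\<close> the signs have to be controlled\<close>
  have same_signs: "\<forall>\<^sub>F x in ?F. \<forall>c\<in>Basis. 0 < (x \<bullet> c) * (a \<bullet> c)"
  proof (intro eventually_ball_finite ballI)
    fix c :: "real ^ 'n" assume "c \<in> Basis"
    then have "a \<bullet> c \<noteq> 0" using a_abs[of c] r by auto
    then have "0 < (a \<bullet> c) * (a \<bullet> c)" by (simp add: zero_less_mult_iff linorder_neq_iff disj_commute)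
    moreover have "((\<lambda>x. (x \<bullet> c) * (a \<bullet> c)) \<longlongrightarrow> (a \<bullet> c) * (a \<bullet> c)) ?F" by (intro tendsto_intros)
    ultimately show "\<forall>\<^sub>F x in ?F. 0 < (x \<bullet> c) * (a \<bullet> c)" by (rule order_tendstoD(1)[rotated])
  qed simp
  have "\<forall>\<^sub>F x in ?F. M (h x) < irwin_hall (m + 4) \<sigma> * (\<Prod>c\<in>Basis. 1 + h x c)"
    unfolding M_def
  proof (rule perturbed_section_less)
    show "((\<lambda>x. h x c) \<longlongrightarrow> 0) ?F" if "c \<in> Basis" for c
    proof -
      have "((\<lambda>x. h x c) \<longlongrightarrow> r * \<bar>a \<bullet> c\<bar> - 1) ?F" unfolding h_def by (intro tendsto_intros)
      then show ?thesis using h_a[OF that] by (simp add: h_def)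
    qed
    show "\<forall>\<^sub>F x in ?F. (\<Sum>c\<in>Basis. h x c) = - (\<Sum>c\<in>Basis. (h x c)\<^sup>2) / 2"
      using on_sphere
    proof eventually_elim
      case (elim x)
      have "(\<Sum>c\<in>Basis. (1 + h x c)\<^sup>2) = r * r * (\<Sum>c\<in>Basis. (x \<bullet> c) * (x \<bullet> c))"
        by (simp add: h_def power2_eq_square sum_distrib_left mult_ac abs_mult_self_eq)
      also have "\<dots> = real m + 4" using elim r by (simp add: euclidean_inner[symmetric] norm_eq_1)
      finally have "(\<Sum>c\<in>Basis. (1 + h x c)\<^sup>2) = real m + 4" .
      moreover have "(\<Sum>c\<in>Basis. (1 + h x c)\<^sup>2) = real m + 4 + 2 * (\<Sum>c\<in>Basis. h x c) + (\<Sum>c\<in>Basis. (h x c)\<^sup>2)"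
        by (simp add: power2_sum sum.distrib sum_distrib_left card)
      ultimately show ?case by simp
    qed
    show "\<forall>\<^sub>F x in ?F. 0 < (\<Sum>c\<in>Basis. (h x c)\<^sup>2)"
      using on_sphere same_signs
    proof eventually_elim
      case (elim x)
      show ?case
      proof (rule ccontr)
        assume "\<not> 0 < (\<Sum>c\<in>Basis. (h x c)\<^sup>2)"
        moreover have "0 \<le> (\<Sum>c\<in>Basis. (h x c)\<^sup>2)" by (intro sum_nonneg) simp
        ultimately have "(\<Sum>c\<in>Basis. (h x c)\<^sup>2) = 0" by linarith
        then have "h x c = 0" if "c \<in> Basis" for c
          using that by (subst (asm) sum_nonneg_eq_0_iff) auto
        then have "h x c = h a c" if "c \<in> Basis" for c using that h_a by metis
        then have abs: "\<bar>x \<bullet> c\<bar> = \<bar>a \<bullet> c\<bar>" if "c \<in> Basis" for c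
          using that r(1) by (simp add: h_def)
        have "x \<bullet> c = a \<bullet> c" if "c \<in> Basis" for c
        proof (rule ccontr)
          assume "x \<bullet> c \<noteq> a \<bullet> c"
          then have "x \<bullet> c = - (a \<bullet> c)" using abs[OF that] by (simp add: abs_eq_iff)
          then have "(x \<bullet> c) * (a \<bullet> c) = - ((a \<bullet> c) * (a \<bullet> c))" by simp
          moreover have "0 \<le> (a \<bullet> c) * (a \<bullet> c)" by simp
          moreover have "0 < (x \<bullet> c) * (a \<bullet> c)" using elim(2) that by blast
          ultimately show False by linarith
        qed
        then have "x = a" by (rule euclidean_eqI)
        then show False using elim by simp
      qed
    qed
    show "4 * irwin_hall (m + 4) \<sigma>
       < irwin_hall (m + 3) \<sigma> + irwin_hall (m + 3) (\<sigma> - 1) + 2 * irwin_hall (m + 2) (\<sigma> - 1)"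
      using \<sigma> by (rule irwin_hall_curvature)
  qed (simp_all add: card)
  then have "\<forall>\<^sub>F x in ?F. section_volume t x < section_volume t a"
    using on_sphere same_signs
  proof eventually_elim
    case (elim x)
    have nz: "x \<bullet> c \<noteq> 0" if "c \<in> Basis" for c using elim(3) that by force
    have "0 < 1 + h x c" if "c \<in> Basis" for c using nz[OF that] r by (simp add: h_def)
    then have "0 < (\<Prod>c\<in>Basis. 1 + h x c)" by (intro prod_pos) auto
    then have "M (h x) / (\<Prod>c\<in>Basis. 1 + h x c) < irwin_hall (m + 4) \<sigma>"
      using elim(1) by (simp add: pos_divide_less_eq)
    then have "r * (M (h x) / (\<Prod>c\<in>Basis. 1 + h x c)) < r * irwin_hall (m + 4) \<sigma>"
      using r(1) by (rule mult_strict_left_mono)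
    then show ?case using vol[of x] nz elim(2) by (simp add: vol_a)
  qed
  then show "strict_local_max_on (sphere 0 1) (section_volume t) a"
    using a by (simp add: strict_local_max_on_def)
qed

end
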